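(* Let $\Bbbk$ be a field of characteristic $0$, let $\phi:U(W_+)\to S$ be the algebra homomorphism described in the context, and let $B:=\phi(U(W_+))$. Then the ring $B$ satisfies the ascending chain condition on two-sided ideals.
   Context: The positive Witt algebra $W_+$ is the Lie algebra over $\Bbbk$ with basis $\{e_n\}_{n\geq 1}$ and bracket $[e_n,e_m]=(m-n)e_{n+m}$; $U(W_+)$ is its universal enveloping algebra. $S$ is the $\Bbbk$-algebra generated by $u,v,w$ subject to $uv-vu-v^2=0$, $uw-wu-vw=0$, $vw-wv=0$. $\phi: U(W_+)\to S$ is the (well-defined) algebra homomorphism with $\phi(e_n)=(u-(n-1)w)v^{n-1}$ for all $n\ge1$. *)

theory Defs
  imports Complex_Main "HOL-Library.Poly_Mapping" "HOL-Algebra.QuotRing"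
begin

section \<open>Free algebras and algebras given by generators and relations\<close>

text \<open>Words, written additively so that \<open>'x fword \<Rightarrow>\<^sub>0 'k\<close> carries the convolution product of
  \<^theory>\<open>HOL-Library.Poly_Mapping\<close>: it is the free associative unital \<open>'k\<close>-algebra on \<open>'x\<close>.\<close>

datatype 'x fword = Word (letters: "'x list")

instantiation fword :: (type) monoid_add
begin

definition zero_fword :: "'x fword" where "zero_fword = Word []"

definition plus_fword :: "'x fword \<Rightarrow> 'x fword \<Rightarrow> 'x fword"
  where "plus_fword a b = Word (letters a @ letters b)"

instance
  by standard (simp_all add: zero_fword_def plus_fword_def)

end

type_synonym ('x, 'k) free_alg = "'x fword \<Rightarrow>\<^sub>0 'k"

definition free_algebra :: "('x, 'k::field) free_alg ring"
  where "free_algebra = \<lparr>carrier = UNIV, mult = (*), one = 1, zero = 0, add = (+)\<rparr>"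

definition letter :: "'x \<Rightarrow> ('x, 'k::field) free_alg"
  where "letter x = Poly_Mapping.single (Word [x]) 1"

definition scalar :: "'k::field \<Rightarrow> ('x, 'k) free_alg"
  where "scalar c = Poly_Mapping.single 0 c"

definition presented_algebra :: "('x, 'k::field) free_alg set \<Rightarrow> ('x, 'k) free_alg set ring"
  where "presented_algebra R = free_algebra Quot (Idl\<^bsub>free_algebra\<^esub> R)"

definition residue :: "('x, 'k::field) free_alg set \<Rightarrow> ('x, 'k) free_alg \<Rightarrow> ('x, 'k) free_alg set"
  where "residue R p = Idl\<^bsub>free_algebra\<^esub> R +>\<^bsub>free_algebra\<^esub> p"

text \<open>The \<open>'k\<close>-algebra structure of a presented algebra is given by the classes of the scalars, so
  a \<open>'k\<close>-algebra homomorphism is a unital ring homomorphism that fixes these.\<close>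

definition algebra_hom ::
  "('x, 'k::field) free_alg set \<Rightarrow> ('y, 'k) free_alg set
    \<Rightarrow> (('x, 'k) free_alg set \<Rightarrow> ('y, 'k) free_alg set) \<Rightarrow> bool"
  where "algebra_hom R R' \<phi> \<longleftrightarrow>
    \<phi> \<in> ring_hom (presented_algebra R) (presented_algebra R') \<and>
    (\<forall>c. \<phi> (residue R (scalar c)) = residue R' (scalar c))"


section \<open>Universal enveloping algebras\<close>

locale lie_algebra = vector_space scale
  for scale :: "'k::field \<Rightarrow> 'l::ab_group_add \<Rightarrow> 'l" +
  fixes bracket :: "'l \<Rightarrow> 'l \<Rightarrow> 'l"
  assumes bracket_add_left: "bracket (x + y) z = bracket x z + bracket y z"
    and bracket_add_right: "bracket x (y + z) = bracket x y + bracket x z"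
    and bracket_scale_left: "bracket (scale c x) y = scale c (bracket x y)"
    and bracket_scale_right: "bracket x (scale c y) = scale c (bracket x y)"
    and bracket_self: "bracket x x = 0"
    and jacobi: "bracket x (bracket y z) + bracket y (bracket z x) + bracket z (bracket x y) = 0"

text \<open>The first two families of relations turn the free algebra on the set underlying a Lie algebra
  into its tensor algebra; the third identifies brackets with commutators.\<close>

definition uea_relations ::
  "('k::field \<Rightarrow> 'l::ab_group_add \<Rightarrow> 'l) \<Rightarrow> ('l \<Rightarrow> 'l \<Rightarrow> 'l) \<Rightarrow> ('l, 'k) free_alg set"
  where "uea_relations scale bracket =
    {letter (x + y) - letter x - letter y | x y. True} \<union>
    {letter (scale c x) - scalar c * letter x | c x. True} \<union>
    {letter x * letter y - letter y * letter x - letter (bracket x y) | x y. True}"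


section \<open>The positive Witt algebra\<close>

text \<open>\<^typ>\<open>num\<close> is the library's type of positive integers, so \<open>num \<Rightarrow>\<^sub>0 'k\<close> is the vector space with
  basis indexed by the integers \<open>n \<ge> 1\<close>; \<open>numeral n\<close> is \<open>n\<close> as an element of \<open>'k\<close>.\<close>

type_synonym 'k witt = "num \<Rightarrow>\<^sub>0 'k"

definition witt_e :: "num \<Rightarrow> 'k::field witt"
  where "witt_e n = Poly_Mapping.single n 1"

definition witt_scale :: "'k::field \<Rightarrow> 'k witt \<Rightarrow> 'k witt"
  where "witt_scale c = Poly_Mapping.map ((*) c)"

definition witt_bracket :: "'k::field witt \<Rightarrow> 'k witt \<Rightarrow> 'k witt"
  where "witt_bracket f g =
    (\<Sum>n\<in>Poly_Mapping.keys f. \<Sum>m\<in>Poly_Mapping.keys g.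
      witt_scale (Poly_Mapping.lookup f n * Poly_Mapping.lookup g m * (numeral m - numeral n))
        (witt_e (n + m)))"

definition UW_relations :: "('k::field witt, 'k) free_alg set"
  where "UW_relations = uea_relations witt_scale witt_bracket"

definition UW :: "('k::field witt, 'k) free_alg set ring"
  where "UW = presented_algebra UW_relations"


section \<open>The algebra \<open>S\<close>\<close>

datatype S_gen = gen_u | gen_v | gen_w

definition S_relations :: "(S_gen, 'k::field) free_alg set"
  where "S_relations =
    (let u = letter gen_u; v = letter gen_v; w = letter gen_w in
      {u * v - v * u - v\<^sup>2, u * w - w * u - v * w, v * w - w * v})"

definition S_alg :: "(S_gen, 'k::field) free_alg set ring"
  where "S_alg = presented_algebra S_relations"

text \<open>Such a map exists, see \<open>phi_exists\<close> below.\<close>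

definition is_phi :: "(('k::field witt, 'k) free_alg set \<Rightarrow> (S_gen, 'k) free_alg set) \<Rightarrow> bool"
  where "is_phi \<phi> \<longleftrightarrow> algebra_hom UW_relations S_relations \<phi> \<and>
    (\<forall>n. \<phi> (residue UW_relations (letter (witt_e n))) =
      residue S_relations
        ((letter gen_u - scalar (numeral n - 1) * letter gen_w) * letter gen_v ^ (nat_of_num n - 1)))"


section \<open>Ascending chain condition\<close>

text \<open>\<^locale>\<open>ideal\<close> means two-sided ideal; it does not presuppose commutativity.\<close>

definition acc_ideals :: "('a, 'b) ring_scheme \<Rightarrow> bool"
  where "acc_ideals R \<longleftrightarrow>
    (\<forall>I :: nat \<Rightarrow> 'a set. (\<forall>i. ideal (I i) R) \<and> (\<forall>i. I i \<subseteq> I (Suc i)) \<longrightarrow>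
      (\<exists>N. \<forall>i\<ge>N. I i = I N))"


section \<open>Basic facts on presented algebras\<close>

lemma free_algebra_simps [simp]:
  "carrier free_algebra = UNIV" "x \<otimes>\<^bsub>free_algebra\<^esub> y = x * y" "\<one>\<^bsub>free_algebra\<^esub> = 1"
  "\<zero>\<^bsub>free_algebra\<^esub> = 0" "x \<oplus>\<^bsub>free_algebra\<^esub> y = x + y"
  by (simp_all add: free_algebra_def)

lemma ring_free_algebra: "ring free_algebra"
proof (rule ringI)
  show "abelian_group free_algebra"
    by (rule abelian_groupI)
      (auto simp: algebra_simps intro: exI[of _ "- x" for x] ab_left_minus)
  show "monoid free_algebra"
    by (rule monoidI) (simp_all add: mult.assoc)
qed (simp_all add: algebra_simps)

lemma ideal_Idl: "ideal (Idl\<^bsub>free_algebra\<^esub> R) free_algebra"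
  by (rule ring.genideal_ideal[OF ring_free_algebra]) simp

lemma Idl_self: "p \<in> R \<Longrightarrow> p \<in> Idl\<^bsub>free_algebra\<^esub> R"
  using ring.genideal_self[OF ring_free_algebra, of R] by auto

lemma Idl_closed:
  "0 \<in> Idl\<^bsub>free_algebra\<^esub> R"
  "a \<in> Idl\<^bsub>free_algebra\<^esub> R \<Longrightarrow> b \<in> Idl\<^bsub>free_algebra\<^esub> R \<Longrightarrow> a + b \<in> Idl\<^bsub>free_algebra\<^esub> R"
  "a \<in> Idl\<^bsub>free_algebra\<^esub> R \<Longrightarrow> c * a \<in> Idl\<^bsub>free_algebra\<^esub> R"
  "a \<in> Idl\<^bsub>free_algebra\<^esub> R \<Longrightarrow> a * c \<in> Idl\<^bsub>free_algebra\<^esub> R"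
  using additive_subgroup.zero_closed[OF ideal.axioms(1)[OF ideal_Idl, of R]]
    additive_subgroup.a_closed[OF ideal.axioms(1)[OF ideal_Idl, of R], of a b]
    ideal.I_l_closed[OF ideal_Idl, of a R c] ideal.I_r_closed[OF ideal_Idl, of a R c]
  by simp_all

lemma ring_presented_algebra: "ring (presented_algebra R)"
  unfolding presented_algebra_def by (rule ideal.quotient_is_ring[OF ideal_Idl])

lemma residue_hom: "residue R \<in> ring_hom free_algebra (presented_algebra R)"
proof -
  have "residue R = (+>\<^bsub>free_algebra\<^esub>) (Idl\<^bsub>free_algebra\<^esub> R)"
    by (simp add: residue_def fun_eq_iff)
  then show ?thesis
    unfolding presented_algebra_def using ideal.rcos_ring_hom[OF ideal_Idl, of R] by simp
qed

lemma residue_mult: "residue R p \<otimes>\<^bsub>presented_algebra R\<^esub> residue R q = residue R (p * q)"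
  using ring_hom_mult[OF residue_hom, of p q] by simp

lemma residue_add: "residue R p \<oplus>\<^bsub>presented_algebra R\<^esub> residue R q = residue R (p + q)"
  using ring_hom_add[OF residue_hom, of p q] by simp

lemma residue_one: "\<one>\<^bsub>presented_algebra R\<^esub> = residue R 1"
  using ring_hom_one[OF residue_hom, of R] by simp

lemma carrier_presented_algebra: "carrier (presented_algebra R) = range (residue R)"
  by (auto simp: presented_algebra_def residue_def FactRing_def A_RCOSETS_def')

lemma a_minus_free_algebra: "p \<ominus>\<^bsub>free_algebra\<^esub> q = p - q"
proof -
  interpret F: ring "free_algebra :: ('a, 'b) free_alg ring" by (rule ring_free_algebra)
  have "\<ominus>\<^bsub>free_algebra\<^esub> q = - q"
    by (rule F.minus_equality) simp_all
  then show ?thesis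
    unfolding a_minus_def by simp
qed

lemma residue_eq_iff: "residue R p = residue R q \<longleftrightarrow> p - q \<in> Idl\<^bsub>free_algebra\<^esub> R"
  unfolding residue_def a_minus_free_algebra[symmetric]
  by (rule ring.quotient_eq_iff_same_a_r_cos[OF ring_free_algebra ideal_Idl, symmetric])
    simp_all


section \<open>The positive Witt algebra is a Lie algebra\<close>

lemma lookup_witt_scale [simp]: "Poly_Mapping.lookup (witt_scale c x) n = c * Poly_Mapping.lookup x n"
  by (simp add: witt_scale_def Poly_Mapping.map.rep_eq when_def)

lemma poly_mapping_sum_single:
  "p = (\<Sum>x\<in>Poly_Mapping.keys p. Poly_Mapping.single x (Poly_Mapping.lookup p x))"
  by (rule poly_mapping_eqI)
    (auto simp: lookup_sum lookup_single when_def in_keys_iff sum.delta' if_distrib cong: if_cong)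

interpretation witt: vector_space "witt_scale :: 'k::field \<Rightarrow> 'k witt \<Rightarrow> 'k witt"
  by unfold_locales (auto intro!: poly_mapping_eqI simp: lookup_add algebra_simps)

lemma witt_induct [case_names zero add scale]:
  assumes "P 0" "\<And>x y. P x \<Longrightarrow> P y \<Longrightarrow> P (x + y)" "\<And>c n. P (witt_scale c (witt_e n))"
  shows "P x"
proof -
  have s: "Poly_Mapping.single n c = witt_scale c (witt_e n)" for n c
    by (simp add: witt_scale_def witt_e_def)
  have "P (\<Sum>n\<in>A. witt_scale (Poly_Mapping.lookup x n) (witt_e n))" if "finite A" for A
    using that by (induction A) (auto intro: assms)
  then show ?thesis
    by (subst poly_mapping_sum_single) (simp add: s)
qed

lemma witt_bracket_superset:
  assumes "finite A" "Poly_Mapping.keys f \<subseteq> A" "finite B" "Poly_Mapping.keys g \<subseteq> B"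
  shows "witt_bracket f g = (\<Sum>n\<in>A. \<Sum>m\<in>B.
      witt_scale (Poly_Mapping.lookup f n * Poly_Mapping.lookup g m * (numeral m - numeral n))
        (witt_e (n + m)))"
proof -
  let ?t = "\<lambda>n m. witt_scale
    (Poly_Mapping.lookup f n * Poly_Mapping.lookup g m * (numeral m - numeral n)) (witt_e (n + m))"
  have "witt_bracket f g = (\<Sum>n\<in>Poly_Mapping.keys f. \<Sum>m\<in>B. ?t n m)"
    unfolding witt_bracket_def
    by (intro sum.cong refl sum.mono_neutral_left) (use assms in \<open>auto simp: in_keys_iff\<close>)
  also have "\<dots> = (\<Sum>n\<in>A. \<Sum>m\<in>B. ?t n m)"
    by (rule sum.mono_neutral_left) (use assms in \<open>auto simp: in_keys_iff\<close>)
  finally show ?thesis .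
qed

lemma witt_bracket_add_left: "witt_bracket (x + y) z = witt_bracket x z + witt_bracket y z"
proof -
  let ?A = "Poly_Mapping.keys x \<union> Poly_Mapping.keys y" and ?B = "Poly_Mapping.keys z"
  show ?thesis
    by (simp add: witt_bracket_superset[of ?A _ ?B] keys_add lookup_add algebra_simps
        witt.scale_left_distrib witt.scale_left_diff_distrib sum.distrib sum_subtractf)
qed

lemma num_add_commute: "(m :: num) + n = n + m"
  by (simp add: num_eq_iff nat_of_num_add)

lemma witt_bracket_anti: "witt_bracket x y = - witt_bracket y x"
proof -
  have *: "a * b * (numeral m - numeral n) = - (b * a * (numeral n - numeral m))"
    for a b :: 'a and m n
    by (metis minus_diff_eq mult.commute mult_minus_right)
  have summand: "witt_scale (a * b * (numeral m - numeral n)) (witt_e (n + m)) =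
      - witt_scale (b * a * (numeral n - numeral m)) (witt_e (m + n))" for a b :: 'a and m n
    by (subst *) (simp only: witt.scale_minus_left num_add_commute[of m n])
  show ?thesis
    unfolding witt_bracket_def sum_negf[symmetric]
    by (subst sum.swap) (intro sum.cong refl summand)
qed

lemma witt_bracket_add_right: "witt_bracket x (y + z) = witt_bracket x y + witt_bracket x z"
  by (simp add: witt_bracket_anti[of x] witt_bracket_add_left)

lemma witt_bracket_scale_left: "witt_bracket (witt_scale c x) y = witt_scale c (witt_bracket x y)"
proof -
  have "Poly_Mapping.keys (witt_scale c x) \<subseteq> Poly_Mapping.keys x"
    by (auto simp: in_keys_iff)
  then show ?thesis
    by (subst (1 2) witt_bracket_superset[of "Poly_Mapping.keys x" _ "Poly_Mapping.keys y"])
      (simp_all add: witt.scale_sum_right mult.assoc)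
qed

lemma witt_bracket_scale_right: "witt_bracket x (witt_scale c y) = witt_scale c (witt_bracket x y)"
  by (simp add: witt_bracket_anti[of x] witt_bracket_scale_left witt.scale_minus_right)

lemma witt_bracket_0 [simp]: "witt_bracket 0 x = 0" "witt_bracket x 0 = 0"
  by (simp_all add: witt_bracket_def)

lemma witt_bracket_e: "witt_bracket (witt_e n) (witt_e m) = witt_scale (numeral m - numeral n) (witt_e (n + m))"
  by (simp add: witt_bracket_def) (simp add: witt_e_def)

lemma witt_bracket_self: "witt_bracket x x = 0"
proof (induction x rule: witt_induct)
  case (add x y)
  then show ?case
    using witt_bracket_anti[of x y] by (simp add: witt_bracket_add_left witt_bracket_add_right)
qed (simp_all add: witt_bracket_scale_left witt_bracket_scale_right witt_bracket_e)

lemma witt_jacobi_e: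
  "witt_bracket (witt_e a) (witt_bracket (witt_e b) (witt_e c)) +
   witt_bracket (witt_e b) (witt_bracket (witt_e c) (witt_e a)) +
   witt_bracket (witt_e c) (witt_bracket (witt_e a) (witt_e b)) = 0"
proof -
  have coeff: "(z - y) * (y + z - x) + (x - z) * (z + x - y) + (y - x) * (x + y - z) = 0"
    for x y z :: 'a
    by (simp add: algebra_simps)
  have "b + (c + a) = a + (b + c)" "c + (a + b) = a + (b + c)"
    by (simp_all add: num_eq_iff nat_of_num_add)
  then show ?thesis
    by (simp only: witt_bracket_e witt_bracket_scale_right witt.scale_scale
        witt.scale_left_distrib[symmetric] numeral_add coeff witt.scale_zero_left)
qed

lemma witt_jacobi:
  "witt_bracket x (witt_bracket y z) + witt_bracket y (witt_bracket z x) +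
   witt_bracket z (witt_bracket x y) = 0" (is "?J x y z = 0")
proof -
  note lin = witt_bracket_add_left witt_bracket_add_right witt_bracket_scale_left
    witt_bracket_scale_right
  have add: "?J (x + x') y z = ?J x y z + ?J x' y z" "?J x (y + y') z = ?J x y z + ?J x y' z"
    "?J x y (z + z') = ?J x y z + ?J x y z'" for x x' y y' z z'
    by (simp_all add: lin algebra_simps)
  have scale: "?J (witt_scale c x) y z = witt_scale c (?J x y z)"
    "?J x (witt_scale c y) z = witt_scale c (?J x y z)"
    "?J x y (witt_scale c z) = witt_scale c (?J x y z)" for c x y z
    by (simp_all only: lin witt.scale_right_distrib)
  have 1: "?J (witt_e a) (witt_e b) z = 0" for a b
    by (induction z rule: witt_induct) (simp_all only: add scale witt_jacobi_e, simp_all)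
  have 2: "?J (witt_e a) y z = 0" for a
    by (induction y rule: witt_induct) (simp_all only: add scale 1, simp_all)
  show ?thesis
    by (induction x rule: witt_induct) (simp_all only: add scale 2, simp_all)
qed

lemma lie_algebra_witt: "lie_algebra (witt_scale :: 'k::field \<Rightarrow> _) witt_bracket"
  by unfold_locales
    (rule witt_bracket_add_left witt_bracket_add_right witt_bracket_scale_left
      witt_bracket_scale_right witt_bracket_self witt_jacobi)+


section \<open>Existence of \<open>\<phi>\<close>\<close>

lemma scalar_add: "scalar (a + b) = scalar a + scalar b"
  by (simp add: scalar_def single_add)

lemma scalar_mult: "scalar (a * b) = scalar a * scalar b"
  by (simp add: scalar_def mult_single)

lemma scalar_0 [simp]: "scalar 0 = 0" and scalar_1 [simp]: "scalar 1 = 1"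
  by (simp_all add: scalar_def)

lemma scalar_minus: "scalar (- a) = - scalar a" and scalar_diff: "scalar (a - b) = scalar a - scalar b"
  by (simp_all add: scalar_def single_uminus single_diff)

lemma scalar_commute: "p * scalar c = scalar c * p"
  by (subst (1 2) poly_mapping_sum_single[of p])
    (simp add: sum_distrib_left sum_distrib_right scalar_def mult_single mult.commute)

lemma scalar_left_commute: "p * (scalar c * q) = scalar c * (p * q)"
  by (metis scalar_commute mult.assoc)

definition mon_eval :: "('x \<Rightarrow> ('y, 'k::field) free_alg) \<Rightarrow> 'x fword \<Rightarrow> ('y, 'k) free_alg"
  where "mon_eval f w = prod_list (map f (letters w))"

definition free_eval :: "('x \<Rightarrow> ('y, 'k::field) free_alg) \<Rightarrow> ('x, 'k) free_alg \<Rightarrow> ('y, 'k) free_alg"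
  where "free_eval f p = (\<Sum>w\<in>Poly_Mapping.keys p. scalar (Poly_Mapping.lookup p w) * mon_eval f w)"

lemma mon_eval_plus: "mon_eval f (a + b) = mon_eval f a * mon_eval f b"
  by (simp add: mon_eval_def plus_fword_def)

lemma mon_eval_0: "mon_eval f 0 = 1"
  by (simp add: mon_eval_def zero_fword_def)

lemma free_eval_superset:
  assumes "finite A" "Poly_Mapping.keys p \<subseteq> A"
  shows "free_eval f p = (\<Sum>w\<in>A. scalar (Poly_Mapping.lookup p w) * mon_eval f w)"
  unfolding free_eval_def
  by (rule sum.mono_neutral_left) (use assms in \<open>auto simp: in_keys_iff\<close>)

lemma free_eval_add: "free_eval f (p + q) = free_eval f p + free_eval f q"
proof -
  let ?A = "Poly_Mapping.keys p \<union> Poly_Mapping.keys q"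
  have "free_eval f (p + q) = (\<Sum>w\<in>?A. scalar (Poly_Mapping.lookup (p + q) w) * mon_eval f w)"
    by (rule free_eval_superset) (simp_all add: keys_add)
  then show ?thesis
    by (simp add: free_eval_superset[of ?A p] free_eval_superset[of ?A q] lookup_add scalar_add
        distrib_right sum.distrib)
qed

lemma free_eval_0: "free_eval f 0 = 0"
  by (simp add: free_eval_def)

lemma free_eval_minus: "free_eval f (p - q) = free_eval f p - free_eval f q"
  using free_eval_add[of f "p - q" q] by simp

lemma free_eval_sum: "free_eval f (\<Sum>i\<in>I. g i) = (\<Sum>i\<in>I. free_eval f (g i))"
  by (induction I rule: infinite_finite_induct) (simp_all add: free_eval_0 free_eval_add)

lemma free_eval_single: "free_eval f (Poly_Mapping.single w c) = scalar c * mon_eval f w"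
  by (simp add: free_eval_def)

lemma free_eval_mult: "free_eval f (p * q) = free_eval f p * free_eval f q"
proof -
  let ?s = "\<lambda>p x. Poly_Mapping.single x (Poly_Mapping.lookup p x)"
  have "p * q = (\<Sum>x\<in>Poly_Mapping.keys p. \<Sum>y\<in>Poly_Mapping.keys q. ?s p x * ?s q y)"
    by (subst poly_mapping_sum_single[of p], subst poly_mapping_sum_single[of q])
      (simp add: sum_product)
  then have "free_eval f (p * q) =
      (\<Sum>x\<in>Poly_Mapping.keys p. \<Sum>y\<in>Poly_Mapping.keys q.
        (scalar (Poly_Mapping.lookup p x) * mon_eval f x) * (scalar (Poly_Mapping.lookup q y) * mon_eval f y))"
    by (simp add: free_eval_sum mult_single free_eval_single mon_eval_plus scalar_mult mult.assoc
        scalar_left_commute[of "mon_eval f x" for x])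
  also have "\<dots> = free_eval f p * free_eval f q"
    by (simp add: free_eval_def sum_product)
  finally show ?thesis .
qed

lemma free_eval_scalar: "free_eval f (scalar c) = scalar c"
  using free_eval_single[of f 0 c] by (simp add: mon_eval_0 scalar_def)

lemma free_eval_1: "free_eval f 1 = 1"
  using free_eval_scalar[of f 1] by simp

lemma free_eval_letter: "free_eval f (letter x) = f x"
  by (simp add: letter_def free_eval_single mon_eval_def)

lemma algebra_hom_exists:
  assumes rel: "\<And>r. r \<in> R \<Longrightarrow> free_eval f r \<in> Idl\<^bsub>free_algebra\<^esub> R'"
  shows "\<exists>\<phi>. algebra_hom R R' \<phi> \<and> (\<forall>p. \<phi> (residue R p) = residue R' (free_eval f p))"
proof -
  let ?J = "Idl\<^bsub>free_algebra\<^esub> R'"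
  note J0 = Idl_closed(1)[of R'] and Jadd = Idl_closed(2)[of _ R'] and Jl = Idl_closed(3)[of _ R']
    and Jr = Idl_closed(4)[of _ R']
  have Jneg: "- a \<in> ?J" if "a \<in> ?J" for a
    using Jl[OF that, of "- 1"] by simp
  let ?K = "{p. free_eval f p \<in> ?J}"
  have "ideal ?K free_algebra"
  proof (rule idealI[OF ring_free_algebra])
    show "subgroup ?K (add_monoid free_algebra)"
    proof (rule group.subgroupI)
      show "group (add_monoid free_algebra)"
        by (rule abelian_group.a_group[OF ring.is_abelian_group[OF ring_free_algebra]])
      show "inv\<^bsub>add_monoid free_algebra\<^esub> a \<in> ?K" if "a \<in> ?K" for a
      proof -
        have "inv\<^bsub>add_monoid free_algebra\<^esub> a = - a"
          using a_minus_free_algebra[of 0 a]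
          by (simp add: a_minus_def a_inv_def)
        with that Jneg[of "free_eval f a"] show ?thesis
          using free_eval_minus[of f 0 a] by (simp add: free_eval_0)
      qed
    qed (auto simp: free_eval_add free_eval_0 J0 intro!: Jadd exI[of _ 0])
  qed (auto simp: free_eval_mult intro: Jl Jr)
  then have "Idl\<^bsub>free_algebra\<^esub> R \<subseteq> ?K"
    by (rule ring.genideal_minimal[OF ring_free_algebra]) (auto intro: rel)
  then have wd: "residue R' (free_eval f p) = residue R' (free_eval f q)"
    if "residue R p = residue R q" for p q
    using that unfolding residue_eq_iff by (auto simp: free_eval_minus)
  define \<phi> where "\<phi> X = residue R' (free_eval f (SOME p. residue R p = X))" for X
  have \<phi>: "\<phi> (residue R p) = residue R' (free_eval f p)" for p
    unfolding \<phi>_def by (rule wd, rule someI[of _ p], rule refl)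
  have "\<phi> \<in> ring_hom (presented_algebra R) (presented_algebra R')"
    by (rule ring_hom_memI)
      (auto simp: carrier_presented_algebra residue_mult residue_add residue_one \<phi> free_eval_mult
        free_eval_add free_eval_1)
  then have "algebra_hom R R' \<phi>"
    by (simp add: algebra_hom_def \<phi> free_eval_scalar)
  with \<phi> show ?thesis by blast
qed

definition witt_image :: "num \<Rightarrow> (S_gen, 'k::field) free_alg"
  where "witt_image n =
    (letter gen_u - scalar (numeral n - 1) * letter gen_w) * letter gen_v ^ (nat_of_num n - 1)"

definition witt_lin :: "'k::field witt \<Rightarrow> (S_gen, 'k) free_alg"
  where "witt_lin x = (\<Sum>n\<in>Poly_Mapping.keys x. scalar (Poly_Mapping.lookup x n) * witt_image n)"

lemma witt_lin_superset:
  assumes "finite A" "Poly_Mapping.keys p \<subseteq> A"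
  shows "witt_lin p = (\<Sum>w\<in>A. scalar (Poly_Mapping.lookup p w) * witt_image w)"
  unfolding witt_lin_def
  by (rule sum.mono_neutral_left) (use assms in \<open>auto simp: in_keys_iff\<close>)

lemma witt_lin_0: "witt_lin 0 = 0"
  by (simp add: witt_lin_def)

lemma witt_lin_add: "witt_lin (p + q) = witt_lin p + witt_lin q"
proof -
  let ?A = "Poly_Mapping.keys p \<union> Poly_Mapping.keys q"
  have "witt_lin (p + q) = (\<Sum>w\<in>?A. scalar (Poly_Mapping.lookup (p + q) w) * witt_image w)"
    by (rule witt_lin_superset) (simp_all add: keys_add)
  then show ?thesis
    by (simp add: witt_lin_superset[of ?A p] witt_lin_superset[of ?A q] lookup_add scalar_add
        distrib_right sum.distrib)
qed

lemma witt_lin_sum: "witt_lin (\<Sum>i\<in>I. g i) = (\<Sum>i\<in>I. witt_lin (g i))"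
  by (induction I rule: infinite_finite_induct) (simp_all add: witt_lin_0 witt_lin_add)

lemma witt_lin_scale: "witt_lin (witt_scale c x) = scalar c * witt_lin x"
proof -
  have "witt_lin (witt_scale c x) =
      (\<Sum>w\<in>Poly_Mapping.keys x. scalar (Poly_Mapping.lookup (witt_scale c x) w) * witt_image w)"
    by (rule witt_lin_superset) (auto simp: in_keys_iff)
  then show ?thesis
    by (simp add: witt_lin_def sum_distrib_left scalar_mult mult.assoc)
qed

lemma witt_lin_e: "witt_lin (witt_e n) = witt_image n"
  by (simp add: witt_lin_def witt_e_def)

lemma witt_image_commutator:
  "residue S_relations (witt_image n * witt_image m - witt_image m * witt_image n) =
   residue S_relations (scalar (numeral m - numeral n) * witt_image (n + m) :: (S_gen, 'k::field) free_alg)"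
proof -
  define eq :: "(S_gen, 'k) free_alg \<Rightarrow> (S_gen, 'k) free_alg \<Rightarrow> bool" (infix "\<triangleq>" 50)
    where "p \<triangleq> q \<longleftrightarrow> residue S_relations p = residue S_relations q" for p q
  have refl: "p \<triangleq> p" and sym: "p \<triangleq> q \<Longrightarrow> q \<triangleq> p"
    and trans [trans]: "p \<triangleq> q \<Longrightarrow> q \<triangleq> r \<Longrightarrow> p \<triangleq> r" for p q r
    by (simp_all add: eq_def)
  have eq_mult: "p * q \<triangleq> p' * q'" and eq_add: "p + q \<triangleq> p' + q'"
    if "p \<triangleq> p'" "q \<triangleq> q'" for p q p' q'
    using that unfolding eq_def by (metis residue_mult, metis residue_add)
  have eq_uminus: "- p \<triangleq> - q" if "p \<triangleq> q" for p q
    using eq_mult[OF refl[of "- 1"] that] by simp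
  have eq_minus: "p - q \<triangleq> p' - q'" if "p \<triangleq> p'" "q \<triangleq> q'" for p q p' q'
    using eq_add[OF that(1) eq_uminus[OF that(2)]] by simp
  define u v w :: "(S_gen, 'k) free_alg"
    where "u = letter gen_u" and "v = letter gen_v" and "w = letter gen_w"
  note sc = scalar_left_commute[of u] scalar_left_commute[of v] scalar_left_commute[of w]
    scalar_left_commute[of "v ^ k" for k] scalar_left_commute[of "scalar a" for a]
  have rel: "p \<triangleq> q" if "p - q \<in> S_relations" for p q
    using that by (simp add: eq_def residue_eq_iff Idl_self)
  have vu: "v * u \<triangleq> u * v - v * v" 
    by (rule sym, rule rel) (simp add: S_relations_def Let_def u_def v_def w_def power2_eq_square)
  have "w * v \<triangleq> v * w"
    by (rule sym, rule rel) (simp add: S_relations_def Let_def u_def v_def w_def)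
  note wv = this
  have "u * w - w * u \<triangleq> v * w"
    by (rule rel) (simp add: S_relations_def Let_def u_def v_def w_def)
  from eq_minus[OF refl[of "u * w"] this]
  have "w * u \<triangleq> u * w - v * w" by simp
  also have "\<dots> \<triangleq> u * w - w * v" by (intro eq_minus refl sym[OF wv])
  finally have wu: "w * u \<triangleq> u * w - w * v" .
  have vku: "v ^ k * u \<triangleq> u * v ^ k - scalar (of_nat k) * v ^ (k + 1)" for k
  proof (induction k)
    case 0 show ?case by (simp add: refl)
  next
    case (Suc k)
    have "v ^ Suc k * u = v * (v ^ k * u)" by (simp add: mult.assoc)
    also have "\<dots> \<triangleq> v * (u * v ^ k - scalar (of_nat k) * v ^ (k + 1))"
      by (intro eq_mult refl Suc)
    also have "\<dots> = (v * u) * v ^ k - scalar (of_nat k) * v ^ (k + 2)"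
      by (simp add: right_diff_distrib sc mult.assoc)
    also have "\<dots> \<triangleq> (u * v - v * v) * v ^ k - scalar (of_nat k) * v ^ (k + 2)"
      by (intro eq_mult eq_minus refl vu)
    also have "\<dots> = u * v ^ Suc k - scalar (of_nat (Suc k)) * v ^ (Suc k + 1)"
      by (simp add: algebra_simps scalar_add)
    finally show ?case .
  qed
  have vkw: "v ^ k * w \<triangleq> w * v ^ k" for k
  proof (induction k)
    case 0 show ?case by (simp add: refl)
  next
    case (Suc k)
    have "v ^ Suc k * w = v * (v ^ k * w)" by (simp add: mult.assoc)
    also have "\<dots> \<triangleq> v * (w * v ^ k)" by (intro eq_mult refl Suc)
    also have "\<dots> = (v * w) * v ^ k" by (simp add: mult.assoc)
    also have "\<dots> \<triangleq> (w * v) * v ^ k" by (intro eq_mult refl sym[OF wv])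
    finally show ?case by (simp add: mult.assoc)
  qed
  define E where "E k = (u - scalar (of_nat k) * w) * v ^ k" for k
  define N where "N k l = (u * u - scalar (of_nat k) * (u * v) - scalar (of_nat l) * (u * w)
      - scalar (of_nat k) * (u * w) + scalar (of_nat k + of_nat k * of_nat k) * (w * v)
      + scalar (of_nat k * of_nat l) * (w * w)) * v ^ (k + l)" for k l
  have EE: "E k * E l \<triangleq> N k l" for k l
  proof -
    let ?a = "scalar (of_nat k) :: (S_gen, 'k) free_alg"
    let ?b = "scalar (of_nat l) :: (S_gen, 'k) free_alg"
    have "E k * E l = (u - ?a * w) * (v ^ k * u - ?b * (v ^ k * w)) * v ^ l"
      by (simp add: E_def right_diff_distrib left_diff_distrib mult.assoc sc)
    also have "\<dots> \<triangleq> (u - ?a * w) * ((u * v ^ k - ?a * v ^ (k + 1)) - ?b * (w * v ^ k)) * v ^ l"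
      by (intro eq_mult eq_minus refl vku vkw)
    also have "\<dots> = (u * u - ?a * (u * v) - ?b * (u * w) - ?a * (w * u) + ?a * (?a * (w * v))
        + ?a * (?b * (w * w))) * v ^ (k + l)"
      by (simp add: right_diff_distrib left_diff_distrib distrib_left distrib_right mult.assoc
          sc power_add)
    also have "\<dots> \<triangleq> (u * u - ?a * (u * v) - ?b * (u * w) - ?a * (u * w - w * v) + ?a * (?a * (w * v))
        + ?a * (?b * (w * w))) * v ^ (k + l)"
      by (intro eq_mult eq_minus eq_add refl wu)
    also have "\<dots> = N k l"
      by (simp add: N_def right_diff_distrib left_diff_distrib distrib_left distrib_right mult.assoc
          scalar_add scalar_mult)
    finally show ?thesis .
  qed
  have comm: "E k * E l - E l * E k \<triangleq> scalar (of_nat l - of_nat k) * E (k + l + 1)" for k l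
  proof -
    have "E k * E l - E l * E k \<triangleq> N k l - N l k" by (intro eq_minus EE)
    also have "N k l - N l k = (scalar (of_nat l - of_nat k) * (u * v)
        - scalar ((of_nat l - of_nat k) * (of_nat k + of_nat l + 1)) * (w * v)) * v ^ (k + l)"
    proof -
      have c: "scalar (of_nat k * of_nat l) = (scalar (of_nat l * of_nat k) :: (S_gen, 'k) free_alg)"
        by (simp add: mult.commute)
      have d: "(of_nat l - of_nat k) * (of_nat k + of_nat l + 1) =
          (of_nat l + of_nat l * of_nat l) - (of_nat k + of_nat k * of_nat k :: 'k)"
        by (simp add: algebra_simps)
      have e: "v ^ (l + k) = v ^ (k + l)" by (simp add: add.commute)
      show ?thesis
        unfolding N_def c d e left_diff_distrib[symmetric] scalar_diff by (simp add: left_diff_distrib)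
    qed
    also have "\<dots> = scalar (of_nat l - of_nat k) * E (k + l + 1)"
    proof -
      have *: "(scalar d * (u * v) - scalar (d * s) * (w * v)) * v ^ (k + l) =
          scalar d * ((u - scalar s * w) * v ^ (k + l + 1))" for d s
        by (simp add: scalar_mult right_diff_distrib left_diff_distrib mult.assoc sc)
      show ?thesis by (simp only: * E_def of_nat_add of_nat_1)
    qed
    finally show ?thesis .
  qed
  have num: "\<exists>k. nat_of_num n = Suc k \<and> (numeral n :: 'k) = of_nat k + 1" for n
  proof -
    obtain k where k: "nat_of_num n = Suc k" using nat_of_num_pos[of n] by (cases "nat_of_num n") auto
    have "(numeral n :: 'k) = of_nat (nat_of_num n)"
      by (metis nat_of_num_numeral of_nat_numeral)
    with k show ?thesis by (auto simp: add.commute)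
  qed
  have im: "witt_image n = E (nat_of_num n - 1)" for n
  proof -
    obtain k where k: "nat_of_num n = Suc k" "(numeral n :: 'k) = of_nat k + 1"
      using num[of n] by blast
    have "(numeral n :: 'k) - 1 = of_nat k" unfolding k(2) by simp
    with k(1) show ?thesis
      unfolding witt_image_def E_def u_def v_def w_def by (simp only: diff_Suc_1)
  qed
  obtain k l where kl: "nat_of_num n = Suc k" "(numeral n :: 'k) = of_nat k + 1"
    "nat_of_num m = Suc l" "(numeral m :: 'k) = of_nat l + 1"
    using num[of n] num[of m] by blast
  have "(numeral m - numeral n :: 'k) = of_nat l - of_nat k"
    unfolding kl(2,4) by simp
  moreover have "nat_of_num (n + m) - 1 = k + l + 1"
    by (simp add: nat_of_num_add kl(1,3))
  ultimately show ?thesis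
    using comm[of k l] unfolding eq_def im kl(1,3) diff_Suc_1 by (simp only:)
qed

lemma residue_sum_cong:
  "(\<And>i. i \<in> I \<Longrightarrow> residue R (g i) = residue R (h i)) \<Longrightarrow>
    residue R (\<Sum>i\<in>I. g i) = residue R (\<Sum>i\<in>I. h i)"
  by (induction I rule: infinite_finite_induct) (simp_all flip: residue_add)

lemma witt_lin_bracket:
  "residue S_relations (witt_lin x * witt_lin y - witt_lin y * witt_lin x) =
   residue S_relations (witt_lin (witt_bracket x y))"
proof -
  let ?X = "Poly_Mapping.keys x" and ?Y = "Poly_Mapping.keys y"
  let ?c = "\<lambda>n m. Poly_Mapping.lookup x n * Poly_Mapping.lookup y m"
  have "witt_lin x * witt_lin y - witt_lin y * witt_lin x =
     (\<Sum>n\<in>?X. \<Sum>m\<in>?Y. scalar (?c n m) * (witt_image n * witt_image m - witt_image m * witt_image n))"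
  proof -
    have "witt_lin y * witt_lin x = (\<Sum>n\<in>?X. \<Sum>m\<in>?Y. scalar (?c n m) * (witt_image m * witt_image n))"
      unfolding witt_lin_def sum_product
      by (subst sum.swap) (simp add: scalar_mult mult.assoc scalar_left_commute[of "witt_image n" for n]
          scalar_left_commute[of "scalar a" for a])
    moreover have "witt_lin x * witt_lin y =
        (\<Sum>n\<in>?X. \<Sum>m\<in>?Y. scalar (?c n m) * (witt_image n * witt_image m))"
      unfolding witt_lin_def sum_product
      by (simp add: scalar_mult mult.assoc scalar_left_commute[of "witt_image n" for n])
    ultimately show ?thesis by (simp add: right_diff_distrib sum_subtractf)
  qed
  also have "residue S_relations \<dots> = residue S_relations
     (\<Sum>n\<in>?X. \<Sum>m\<in>?Y. scalar (?c n m) * (scalar (numeral m - numeral n) * witt_image (n + m)))"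
    by (intro residue_sum_cong) (metis witt_image_commutator residue_mult)
  also have "(\<Sum>n\<in>?X. \<Sum>m\<in>?Y. scalar (?c n m) * (scalar (numeral m - numeral n) * witt_image (n + m)))
      = witt_lin (witt_bracket x y)"
    by (simp add: witt_bracket_def witt_lin_sum witt_lin_scale witt_lin_e scalar_mult mult.assoc)
  finally show ?thesis .
qed

theorem phi_exists: "\<exists>\<phi>. is_phi \<phi>"
proof -
  have *: "free_eval witt_lin r \<in> Idl\<^bsub>free_algebra\<^esub> S_relations" if "r \<in> UW_relations" for r
  proof -
    have "residue S_relations (free_eval witt_lin r) = residue S_relations 0"
      using that witt_lin_bracket
      by (auto simp: UW_relations_def uea_relations_def free_eval_minus free_eval_mult
          free_eval_letter free_eval_scalar witt_lin_add witt_lin_scale residue_eq_iff Idl_closed(1))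
    then show ?thesis by (simp add: residue_eq_iff)
  qed
  from algebra_hom_exists[of UW_relations, OF *] show ?thesis
    unfolding is_phi_def witt_image_def[symmetric] by (metis free_eval_letter witt_lin_e)
qed

lemma ring_image_phi:
  assumes "is_phi \<phi>"
  shows "ring (S_alg\<lparr>carrier := \<phi> ` carrier UW\<rparr>)"
proof -
  have "ring_hom_ring UW S_alg \<phi>"
    using assms unfolding is_phi_def algebra_hom_def UW_def S_alg_def
    by (intro ring_hom_ringI2 ring_presented_algebra) auto
  then show ?thesis by (rule ring_hom_ring.img_is_ring)
qed

end

(*
  Writing the elements of S in the normal form sum c w^k v^j u^i identifies S with k[u,v,w] as a
  vector space.  On normal forms, right multiplication by u is multiplication by u, the commutator
  with u is the derivation D = v (v d/dv + w d/dw), and left multiplication by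
  e_1 e_3 - e_2 e_2 - e_4 is multiplication by q = w (v - w) v^2.  A two-sided ideal of B is closed
  under these three operations.  For the lexicographic order on (i, k, j) they shift the leading
  exponent by (1,0,0), by (0,0,1) unless k = j = 0, and by (0,2,2).  All exponents occurring in B
  satisfy k <= j, and there these shifts leave no infinite antichains (Dickson); so the sets of
  leading exponents of an ascending chain of ideals stabilise, and with them the ideals.
*)

theory Submission
  imports Defs "HOL-Library.Product_Plus" "HOL-Library.Product_Lexorder"
begin

section \<open>Additive maps on finitely supported functions\<close>

section \<open>Linear extension\<close>

lemma poly_mapping_induct [case_names single add]:
  assumes "\<And>t c. P (Poly_Mapping.single t c)" "\<And>p q. P p \<Longrightarrow> P q \<Longrightarrow> P (p + q)"
  shows "P (p :: 'a \<Rightarrow>\<^sub>0 'b::comm_monoid_add)"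
proof -
  \<comment> \<open>The zero polynomial, the empty sum, is covered as
    \<open>Poly_Mapping.single _ 0\<close>.\<close>
  have "P (\<Sum>t\<in>A. Poly_Mapping.single t (Poly_Mapping.lookup p t))" if "finite A" for A
    using that by (induction A) (use assms(1)[of _ 0] in \<open>auto intro: assms\<close>)
  then show ?thesis
    by (subst poly_mapping_sum_single) simp
qed

text \<open>The coefficient is an argument of \<open>F\<close>, so that one construction serves
  targets with different scalars: \<open>der\<close>, \<open>act\<close> and
  \<open>normal\<close>.\<close>

definition lin_ext :: "('t \<Rightarrow> 'c::zero \<Rightarrow> 'm::comm_monoid_add) \<Rightarrow> ('t \<Rightarrow>\<^sub>0 'c) \<Rightarrow> 'm"
  where "lin_ext F p = (\<Sum>t\<in>Poly_Mapping.keys p. F t (Poly_Mapping.lookup p t))"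

lemma lin_ext_0 [simp]: "lin_ext F 0 = 0"
  by (simp add: lin_ext_def)

lemma lin_ext_single: "F t 0 = 0 \<Longrightarrow> lin_ext F (Poly_Mapping.single t c) = F t c"
  by (cases "c = 0") (simp_all add: lin_ext_def)

lemma lin_ext_superset:
  assumes "\<And>t. F t 0 = 0" "finite A" "Poly_Mapping.keys p \<subseteq> A"
  shows "lin_ext F p = (\<Sum>t\<in>A. F t (Poly_Mapping.lookup p t))"
  unfolding lin_ext_def
  by (rule sum.mono_neutral_left) (use assms in \<open>auto simp: in_keys_iff\<close>)

lemma lin_ext_add:
  assumes "\<And>t. F t 0 = 0" "\<And>t a b. F t (a + b) = F t a + F t b"
  shows "lin_ext F (p + q) = lin_ext F p + lin_ext F (q :: 't \<Rightarrow>\<^sub>0 'c::comm_monoid_add)"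
proof -
  let ?A = "Poly_Mapping.keys p \<union> Poly_Mapping.keys q"
  note s = lin_ext_superset[of F ?A, OF assms(1)]
  show ?thesis
    by (simp add: s keys_add lookup_add assms(2) sum.distrib)
qed

section \<open>A left S-module structure on k[u,v,w]\<close>

section \<open>The action of \<open>S\<close> on polynomials\<close>

text \<open>The exponent \<open>(i, k, j)\<close> stands for \<open>w\<^sup>k v\<^sup>j u\<^sup>i\<close>; exponents are compared lexicographically.\<close>

type_synonym expo = "nat \<times> nat \<times> nat"

text \<open>Exponents add componentwise, so convolution is the product of the commutative polynomial
  ring, not the product of S.\<close>

definition pu :: "expo \<Rightarrow>\<^sub>0 'k::field" where "pu = Poly_Mapping.single (1, 0, 0) 1"
definition pw :: "expo \<Rightarrow>\<^sub>0 'k::field" where "pw = Poly_Mapping.single (0, 1, 0) 1"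
definition pv :: "expo \<Rightarrow>\<^sub>0 'k::field" where "pv = Poly_Mapping.single (0, 0, 1) 1"

abbreviation const :: "'k::field \<Rightarrow> expo \<Rightarrow>\<^sub>0 'k"
  where "const c \<equiv> Poly_Mapping.single 0 c"

text \<open>The derivation \<open>[u, _]\<close>, which is \<open>v\<close> times the Euler operator in \<open>v\<close> and \<open>w\<close>.\<close>

definition der :: "(expo \<Rightarrow>\<^sub>0 'k::field) \<Rightarrow> (expo \<Rightarrow>\<^sub>0 'k)"
  where "der = lin_ext (\<lambda>(i, k, j) c. Poly_Mapping.single (i, k, Suc j) (of_nat (k + j) * c))"

lemma der_add: "der (p + q) = der p + der q"
  unfolding der_def
  by (rule lin_ext_add) (auto simp: algebra_simps single_add)

lemma der_single: "der (Poly_Mapping.single (i, k, j) c) = Poly_Mapping.single (i, k, Suc j) (of_nat (k + j) * c)"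
  unfolding der_def by (subst lin_ext_single) auto

lemma der_0 [simp]: "der 0 = 0"
  by (simp add: der_def)

lemma der_minus: "der (- p) = - der p"
  by (metis der_add der_0 add.right_inverse minus_unique)

lemma der_diff: "der (p - q) = der p - der q"
  using der_add[of p "- q"] by (simp add: der_minus)

text \<open>Both sides are biadditive, and on monomials the weight \<open>k + j\<close> is
  additive.\<close>

lemma der_mult: "der (p * q) = der p * q + p * der q"
proof (induction p rule: poly_mapping_induct)
  case (single t c)
  show ?case
  proof (induction q rule: poly_mapping_induct)
    case (single s d)
    show ?case
      by (cases t; cases s) (simp add: der_single mult_single algebra_simps flip: single_add)
  qed (simp add: der_add algebra_simps)
qed (simp add: der_add algebra_simps)

lemma der_const [simp]: "der (const c) = 0"
  by (simp add: der_single zero_prod_def)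

lemma der_pu [simp]: "der pu = 0"
  and der_pv [simp]: "der pv = pv * pv"
  and der_pw [simp]: "der pw = pv * pw"
  by (simp_all add: pu_def pv_def pw_def der_single mult_single)

lemma lookup_der:
  "Poly_Mapping.lookup (der p) (i, k, 0) = 0"
  "Poly_Mapping.lookup (der p) (i, k, Suc j) = of_nat (k + j) * Poly_Mapping.lookup p (i, k, j)"
proof -
  show "Poly_Mapping.lookup (der p) (i, k, 0) = 0"
  proof (induction p rule: poly_mapping_induct)
    case (single t c)
    show ?case by (cases t) (simp add: der_single lookup_single)
  qed (simp add: der_add lookup_add)
  show "Poly_Mapping.lookup (der p) (i, k, Suc j) = of_nat (k + j) * Poly_Mapping.lookup p (i, k, j)"
  proof (induction p rule: poly_mapping_induct)
    case (single t c)
    show ?case by (cases t) (auto simp: der_single lookup_single when_def)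
  qed (simp add: der_add lookup_add algebra_simps)
qed

text \<open>Left multiplication by a generator, read on normal forms: moving u to the right past w^k
  v^j costs a commutator, hence the summand \<open>der f\<close>.\<close>

fun gen_act :: "S_gen \<Rightarrow> (expo \<Rightarrow>\<^sub>0 'k::field) \<Rightarrow> (expo \<Rightarrow>\<^sub>0 'k)" where
  "gen_act gen_u f = pu * f + der f"
| "gen_act gen_v f = pv * f"
| "gen_act gen_w f = pw * f"

lemma gen_act_add: "gen_act x (f + g) = gen_act x f + gen_act x g"
  by (cases x) (simp_all add: der_add algebra_simps)

lemma gen_act_const: "gen_act x (const c * f) = const c * gen_act x f"
  by (cases x) (simp_all add: der_mult algebra_simps)

lemma foldr_gen_act_add: "foldr gen_act xs (f + g) = foldr gen_act xs f + foldr gen_act xs g"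
  by (induction xs) (simp_all add: gen_act_add)

lemma foldr_gen_act_const: "foldr gen_act xs (const c * f) = const c * foldr gen_act xs f"
  by (induction xs) (simp_all add: gen_act_const)

definition act :: "(S_gen, 'k::field) free_alg \<Rightarrow> (expo \<Rightarrow>\<^sub>0 'k) \<Rightarrow> (expo \<Rightarrow>\<^sub>0 'k)"
  where "act p f = lin_ext (\<lambda>w c. const c * foldr gen_act (letters w) f) p"

lemma act_add: "act (p + q) f = act p f + act q f"
  unfolding act_def by (rule lin_ext_add) (simp_all add: single_add distrib_right)

lemma act_single: "act (Poly_Mapping.single w c) f = const c * foldr gen_act (letters w) f"
  unfolding act_def by (rule lin_ext_single) simp

lemma act_0 [simp]: "act 0 f = 0"
  by (simp add: act_def)

lemma act_minus: "act (- p) f = - act p f"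
  by (metis act_add act_0 add.right_inverse minus_unique)

lemma act_diff: "act (p - q) f = act p f - act q f"
  using act_add[of p "- q"] by (simp add: act_minus)

lemma act_add_right: "act p (f + g) = act p f + act p g"
  by (induction p rule: poly_mapping_induct)
    (simp_all add: act_single act_add foldr_gen_act_add algebra_simps)

lemma act_zero_right [simp]: "act p 0 = 0"
  using act_add_right[of p 0 0] by simp

lemma act_mult: "act (p * q) f = act p (act q f)"
proof (induction p rule: poly_mapping_induct)
  case (single w c)
  show ?case
  proof (induction q rule: poly_mapping_induct)
    case (single w' c')
    have "const (c * c') = const c * const c'"
      by (simp add: mult_single)
    then show ?case
      by (simp add: mult_single[of w] act_single plus_fword_def foldr_gen_act_const mult.assoc)
  qed (simp add: act_add act_add_right algebra_simps)
qed (simp add: act_add algebra_simps)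

lemma act_letter [simp]: "act (letter x) f = gen_act x f"
  by (simp add: letter_def act_single)

lemma act_scalar [simp]: "act (scalar c) f = const c * f"
  by (simp add: scalar_def act_single zero_fword_def)

lemma act_1 [simp]: "act 1 f = f"
  using act_scalar[of 1 f] by simp

lemma act_power: "act (p ^ n) f = (act p ^^ n) f"
  by (induction n) (simp_all add: act_mult)

text \<open>On normal forms \<open>pu\<close> is right multiplication by u, which commutes with all
  left multiplications; concretely, \<open>der pu = 0\<close>.\<close>

lemma act_pu: "act p (pu * f) = pu * act p f"
proof (induction p rule: poly_mapping_induct)
  case (single w c)
  have "gen_act x (pu * g) = pu * gen_act x g" for x and g :: "expo \<Rightarrow>\<^sub>0 'a"
    by (cases x) (simp_all add: der_mult algebra_simps)
  then have "foldr gen_act xs (pu * f) = pu * foldr gen_act xs f" for xs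
    by (induction xs) simp_all
  then show ?case by (simp add: act_single algebra_simps)
qed (simp add: act_add algebra_simps)

text \<open>By the Leibniz rule, the commutators of u with v and w act as multiplication by
  \<open>der pv\<close> and \<open>der pw\<close>, which are v^2 and vw.\<close>

lemma act_S_relations: "r \<in> S_relations \<Longrightarrow> act r f = 0"
  by (auto simp: S_relations_def Let_def act_diff act_mult power2_eq_square der_mult)
    (simp_all add: algebra_simps)

lemma Idl_minimal:
  assumes "p \<in> Idl\<^bsub>free_algebra\<^esub> R" and "\<And>r. r \<in> R \<Longrightarrow> r \<in> K" "0 \<in> K"
    "\<And>a b. a \<in> K \<Longrightarrow> b \<in> K \<Longrightarrow> a + b \<in> K" "\<And>a c. a \<in> K \<Longrightarrow> c * a \<in> K" "\<And>a c. a \<in> K \<Longrightarrow> a * c \<in> K"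
  shows "p \<in> (K :: ('x, 'k::field) free_alg set)"
proof -
  have "ideal K free_algebra"
  proof (rule idealI[OF ring_free_algebra])
    show "subgroup K (add_monoid free_algebra)"
    proof (rule group.subgroupI)
      show "group (add_monoid free_algebra)"
        by (rule abelian_group.a_group[OF ring.is_abelian_group[OF ring_free_algebra]])
      show "inv\<^bsub>add_monoid free_algebra\<^esub> a \<in> K" if "a \<in> K" for a
        using a_minus_free_algebra[of 0 a] assms(5)[OF that, of "- 1"]
        by (simp add: a_minus_def a_inv_def)
    qed (use assms in auto)
  qed (use assms in auto)
  then have "Idl\<^bsub>free_algebra\<^esub> R \<subseteq> K"
    by (rule ring.genideal_minimal[OF ring_free_algebra]) (use assms in auto)
  with assms(1) show ?thesis by blast
qed

text \<open>The annihilator of the whole module is a two-sided ideal; quantifying over all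
  \<open>f\<close> gives closure under multiplication on the right.\<close>

lemma act_Idl: "p \<in> Idl\<^bsub>free_algebra\<^esub> S_relations \<Longrightarrow> act p f = 0"
  using Idl_minimal[of p S_relations "{p. \<forall>f. act p f = 0}"]
  by (auto simp: act_S_relations act_add act_mult)

section \<open>Normal forms in S\<close>

section \<open>The action is faithful\<close>

definition S_eq :: "(S_gen, 'k::field) free_alg \<Rightarrow> (S_gen, 'k) free_alg \<Rightarrow> bool" (infix "\<approx>" 50)
  where "p \<approx> q \<longleftrightarrow> residue S_relations p = residue S_relations q"

lemma S_eq_refl [simp]: "p \<approx> p" and S_eq_sym: "p \<approx> q \<Longrightarrow> q \<approx> p"
  and S_eq_trans [trans]: "p \<approx> q \<Longrightarrow> q \<approx> r \<Longrightarrow> p \<approx> r"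
  by (simp_all add: S_eq_def)

lemma S_eq_mult: "p \<approx> p' \<Longrightarrow> q \<approx> q' \<Longrightarrow> p * q \<approx> p' * q'"
  and S_eq_add: "p \<approx> p' \<Longrightarrow> q \<approx> q' \<Longrightarrow> p + q \<approx> p' + q'"
  unfolding S_eq_def by (metis residue_mult, metis residue_add)

lemma S_eqI: "p - q \<in> S_relations \<Longrightarrow> p \<approx> q"
  by (simp add: S_eq_def residue_eq_iff Idl_self)

abbreviation "gu \<equiv> letter gen_u"
abbreviation "gv \<equiv> letter gen_v"
abbreviation "gw \<equiv> letter gen_w"

lemma S_vw: "gv * gw \<approx> gw * gv"
  by (rule S_eqI) (simp add: S_relations_def Let_def)

lemma S_uv: "gu * gv \<approx> gv * gu + gv * gv"
  by (rule S_eqI) (simp add: S_relations_def Let_def power2_eq_square diff_diff_eq)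

lemma S_uw: "gu * gw \<approx> gw * gu + gw * gv"
proof -
  have "gu * gw \<approx> gw * gu + gv * gw"
    by (rule S_eqI) (simp add: S_relations_def Let_def diff_diff_eq)
  also have "gw * gu + gv * gw \<approx> gw * gu + gw * gv"
    by (rule S_vw S_eq_refl S_eq_mult S_eq_add)+
  finally show ?thesis .
qed

lemma S_vw_power: "(gv :: (S_gen, 'k::field) free_alg) * gw ^ k \<approx> gw ^ k * gv"
proof (induction k)
  case (Suc k)
  have "(gv :: (S_gen, 'k) free_alg) * gw ^ Suc k = (gv * gw) * gw ^ k" by (simp add: mult.assoc)
  also have "\<dots> \<approx> (gw * gv) * gw ^ k" by (rule S_vw S_eq_refl S_eq_mult S_eq_add)+
  also have "\<dots> = gw * (gv * gw ^ k)" by (simp add: mult.assoc)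
  also have "\<dots> \<approx> gw * (gw ^ k * gv)" by (rule Suc S_eq_refl S_eq_mult S_eq_add)+
  finally show ?case by (simp add: mult.assoc)
qed simp

lemma S_uv_power: "(gu :: (S_gen, 'k::field) free_alg) * gv ^ j \<approx> gv ^ j * gu + scalar (of_nat j) * gv ^ Suc j"
proof (induction j)
  case (Suc j)
  have "(gu :: (S_gen, 'k) free_alg) * gv ^ Suc j = (gu * gv) * gv ^ j" by (simp add: mult.assoc)
  also have "\<dots> \<approx> (gv * gu + gv * gv) * gv ^ j" by (rule S_uv S_eq_refl S_eq_mult S_eq_add)+
  also have "\<dots> = gv * (gu * gv ^ j) + gv ^ Suc (Suc j)" by (simp add: mult.assoc distrib_right)
  also have "\<dots> \<approx> gv * (gv ^ j * gu + scalar (of_nat j) * gv ^ Suc j) + gv ^ Suc (Suc j)"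
    by (rule Suc S_eq_refl S_eq_mult S_eq_add)+
  also have "\<dots> = gv ^ Suc j * gu + scalar (of_nat (Suc j)) * gv ^ Suc (Suc j)"
    by (simp add: distrib_left distrib_right scalar_left_commute[of gv] mult.assoc scalar_add add_ac)
  finally show ?case .
qed simp

lemma S_uw_power: "(gu :: (S_gen, 'k::field) free_alg) * gw ^ k \<approx> gw ^ k * gu + scalar (of_nat k) * (gw ^ k * gv)"
proof (induction k)
  case (Suc k)
  have "(gu :: (S_gen, 'k) free_alg) * gw ^ Suc k = (gu * gw) * gw ^ k" by (simp add: mult.assoc)
  also have "\<dots> \<approx> (gw * gu + gw * gv) * gw ^ k" by (rule S_uw S_eq_refl S_eq_mult S_eq_add)+
  also have "\<dots> = gw * (gu * gw ^ k + gv * gw ^ k)"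
    by (simp add: mult.assoc distrib_right distrib_left)
  also have "\<dots> \<approx> gw * ((gw ^ k * gu + scalar (of_nat k) * (gw ^ k * gv)) + gw ^ k * gv)"
    by (rule Suc S_vw_power S_eq_refl S_eq_mult S_eq_add)+
  also have "\<dots> = gw ^ Suc k * gu + scalar (of_nat (Suc k)) * (gw ^ Suc k * gv)"
    by (simp add: distrib_left distrib_right scalar_left_commute[of gw] mult.assoc scalar_add add_ac)
  finally show ?case .
qed simp

fun normal_mon :: "expo \<Rightarrow> (S_gen, 'k::field) free_alg"
  where "normal_mon (i, k, j) = gw ^ k * gv ^ j * gu ^ i"

text \<open>This mirrors \<open>gen_act gen_u\<close> on a monomial: passing w^k contributes k and
  passing v^j contributes j to the coefficient of the correction.\<close>

lemma gu_normal_mon: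
  "gu * normal_mon (i, k, j) \<approx>
    normal_mon (Suc i, k, j) + scalar (of_nat (k + j)) * normal_mon (i, k, Suc j)"
proof -
  have "gu * normal_mon (i, k, j) = (gu * gw ^ k) * gv ^ j * gu ^ i" by (simp add: mult.assoc)
  also have "\<dots> \<approx> (gw ^ k * gu + scalar (of_nat k) * (gw ^ k * gv)) * gv ^ j * gu ^ i"
    by (rule S_uw_power S_eq_refl S_eq_mult S_eq_add)+
  also have "\<dots> = (gw ^ k * (gu * gv ^ j) + scalar (of_nat k) * (gw ^ k * gv ^ Suc j)) * gu ^ i"
    by (simp add: mult.assoc distrib_right)
  also have "\<dots> \<approx> (gw ^ k * (gv ^ j * gu + scalar (of_nat j) * gv ^ Suc j)
      + scalar (of_nat k) * (gw ^ k * gv ^ Suc j)) * gu ^ i"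
    by (rule S_uv_power S_eq_refl S_eq_mult S_eq_add)+
  also have "\<dots> = normal_mon (Suc i, k, j) + scalar (of_nat (k + j)) * normal_mon (i, k, Suc j)"
    by (simp add: mult.assoc distrib_right distrib_left scalar_left_commute[of "gw ^ k"] scalar_add add_ac)
  finally show ?thesis .
qed

definition normal :: "(expo \<Rightarrow>\<^sub>0 'k::field) \<Rightarrow> (S_gen, 'k) free_alg"
  where "normal = lin_ext (\<lambda>t c. scalar c * normal_mon t)"

lemma normal_single: "normal (Poly_Mapping.single t c) = scalar c * normal_mon t"
  unfolding normal_def by (rule lin_ext_single) simp

lemma normal_add: "normal (p + q) = normal p + normal q"
  unfolding normal_def by (rule lin_ext_add) (simp_all add: scalar_add distrib_right)

text \<open>\<open>normal\<close> intertwines the action on polynomials with left multiplication in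
  S. By additivity it is checked on monomials.\<close>

lemma normal_gen_act: "normal (gen_act x f) \<approx> letter x * normal f"
proof (induction f rule: poly_mapping_induct)
  case (single t c)
  obtain i k j where t: "t = (i, k, j)" by (cases t)
  show ?case
  proof (cases x)
    case gen_u
    have "normal (gen_act gen_u (Poly_Mapping.single t c)) =
        scalar c * (normal_mon (Suc i, k, j) + scalar (of_nat (k + j)) * normal_mon (i, k, Suc j))"
      by (simp add: t pu_def mult_single der_single normal_add normal_single distrib_left
          mult.commute[of _ c] scalar_mult mult.assoc del: normal_mon.simps of_nat_add)
    also have "\<dots> \<approx> scalar c * (gu * normal_mon (i, k, j))"
      by (rule S_eq_sym[OF gu_normal_mon] S_eq_refl S_eq_mult S_eq_add)+
    finally show ?thesis
      by (simp add: gen_u t normal_single scalar_left_commute[of gu] del: normal_mon.simps)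
  next
    case gen_v
    have "normal (gen_act gen_v (Poly_Mapping.single t c)) = scalar c * ((gw ^ k * gv) * gv ^ j * gu ^ i)"
      by (simp add: t pv_def mult_single normal_single mult.assoc)
    also have "\<dots> \<approx> scalar c * ((gv * gw ^ k) * gv ^ j * gu ^ i)"
      by (rule S_eq_sym[OF S_vw_power] S_eq_refl S_eq_mult S_eq_add)+
    finally show ?thesis
      by (simp add: gen_v t normal_single scalar_left_commute[of gv] mult.assoc)
  next
    case gen_w
    then show ?thesis
      by (simp add: t pw_def mult_single normal_single scalar_left_commute[of gw] mult.assoc)
  qed
qed (simp add: gen_act_add normal_add distrib_left S_eq_add)

lemma normal_const: "normal (const c * f) = scalar c * normal f"
  by (induction f rule: poly_mapping_induct)
    (simp_all add: mult_single normal_single normal_add distrib_left scalar_mult mult.assoc)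

text \<open>The coordinates of \<open>p\<close> in the monomials w^k v^j u^i, found by letting
  \<open>p\<close> act on 1.\<close>

definition nf :: "(S_gen, 'k::field) free_alg \<Rightarrow> (expo \<Rightarrow>\<^sub>0 'k)"
  where "nf p = act p 1"

text \<open>A word is built from 1 by left multiplications, each of which \<open>normal\<close>
  respects. Hence the normal monomials span S.\<close>

lemma normal_nf:
  fixes p :: "(S_gen, 'k::field) free_alg"
  shows "normal (nf p) \<approx> p"
proof -
  have n1: "normal 1 = (1 :: (S_gen, 'k) free_alg)"
    using normal_single[of "0" 1] by (simp add: zero_prod_def[symmetric] single_one) (simp add: zero_prod_def)
  have w: "normal (foldr gen_act xs 1) \<approx> (Poly_Mapping.single (Word xs) 1 :: (S_gen, 'k) free_alg)" for xs
  proof (induction xs)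
    case (Cons x xs)
    have "normal (foldr gen_act (x # xs) 1) \<approx> (letter x :: (S_gen, 'k) free_alg) * normal (foldr gen_act xs 1)"
      by (simp add: normal_gen_act)
    also have "\<dots> \<approx> letter x * Poly_Mapping.single (Word xs) 1"
      by (rule Cons S_eq_refl S_eq_mult S_eq_add)+
    finally show ?case
      by (simp add: letter_def mult_single plus_fword_def)
  qed (simp add: n1 flip: zero_fword_def)
  show ?thesis
  proof (induction p rule: poly_mapping_induct)
    case (single t c)
    have "normal (nf (Poly_Mapping.single t c)) \<approx> scalar c * Poly_Mapping.single t 1"
      using w[of "letters t"] by (simp add: nf_def act_single normal_const S_eq_mult)
    then show ?case by (simp add: scalar_def mult_single)
  qed (simp add: nf_def act_add normal_add S_eq_add)
qed

text \<open>\<open>normal\<close> recovers the class from the normal form, and conversely the ideal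
  of relations acts by zero.\<close>

lemma nf_eq_iff: "nf p = nf q \<longleftrightarrow> residue S_relations p = residue S_relations q"
proof
  assume "nf p = nf q"
  with S_eq_trans[OF S_eq_sym[OF normal_nf[of p]], of q] normal_nf[of q]
  show "residue S_relations p = residue S_relations q" by (simp add: S_eq_def)
next
  assume "residue S_relations p = residue S_relations q"
  then have "act (p - q) 1 = 0"
    by (simp add: residue_eq_iff act_Idl)
  then show "nf p = nf q" by (simp add: nf_def act_diff)
qed

section \<open>Leading exponents for the lexicographic order\<close>

section \<open>Leading exponents\<close>

text \<open>A relation instead of a function, so the zero polynomial simply has no leading
  exponent.\<close>

definition is_lead :: "(expo \<Rightarrow>\<^sub>0 'k::field) \<Rightarrow> expo \<Rightarrow> bool"
  where "is_lead f t \<longleftrightarrow> Poly_Mapping.lookup f t \<noteq> 0 \<and> (\<forall>s. Poly_Mapping.lookup f s \<noteq> 0 \<longrightarrow> s \<le> t)"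

lemma lead_exists: "f \<noteq> 0 \<Longrightarrow> \<exists>t. is_lead f t"
  unfolding is_lead_def
  by (rule exI[of _ "Max (Poly_Mapping.keys f)"])
    (use Max_in[of "Poly_Mapping.keys f"] in \<open>auto simp: in_keys_iff\<close>)

lemma lookup_mult_single: "Poly_Mapping.lookup (Poly_Mapping.single s c * f) (s + t) = c * Poly_Mapping.lookup f t"
  for s t :: "'a::cancel_comm_monoid_add" and c :: "'k::field"
  by (induction f rule: poly_mapping_induct)
    (auto simp: mult_single lookup_single when_def lookup_add distrib_left)

lemma lookup_mult_single_nonzero:
  assumes "Poly_Mapping.lookup (Poly_Mapping.single s (c :: 'k::field) * f) t \<noteq> 0"
  obtains r where "t = s + r" "Poly_Mapping.lookup f r \<noteq> 0"
proof -
  have "t \<in> Poly_Mapping.keys (Poly_Mapping.single s c * f)"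
    using assms by (simp add: in_keys_iff)
  then obtain a b where "t = a + b" "a \<in> Poly_Mapping.keys (Poly_Mapping.single s c)" "b \<in> Poly_Mapping.keys f"
    using keys_mult by blast
  then show ?thesis
    using that by (auto simp: in_keys_iff split: if_splits)
qed

lemma expo_add_mono: "(s :: expo) \<le> t \<Longrightarrow> r + s \<le> r + t"
  by (cases r; cases s; cases t) auto

lemma is_lead_mult_single: "is_lead f t \<Longrightarrow> is_lead (Poly_Mapping.single s 1 * f) (s + t)"
  unfolding is_lead_def lookup_mult_single
  by (metis expo_add_mono lookup_mult_single_nonzero mult_1)

lemma is_lead_diff:
  assumes "is_lead f t" "is_lead g s" "s < t"
  shows "is_lead (g - f) t"
proof -
  have g: "r < t" if "Poly_Mapping.lookup g r \<noteq> 0" for r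
    using that assms(2,3) by (meson is_lead_def le_less_trans)
  then have "Poly_Mapping.lookup g t = 0" by blast
  then have "Poly_Mapping.lookup (g - f) t \<noteq> 0"
    using assms(1) by (simp add: is_lead_def lookup_minus)
  moreover have "r \<le> t" if "Poly_Mapping.lookup (g - f) r \<noteq> 0" for r
  proof (cases "Poly_Mapping.lookup g r = 0")
    case True
    with that have "Poly_Mapping.lookup f r \<noteq> 0" by (simp add: lookup_minus)
    with assms(1) show ?thesis unfolding is_lead_def by blast
  qed (use g in \<open>simp add: less_imp_le\<close>)
  ultimately show ?thesis unfolding is_lead_def by blast
qed

section \<open>Effect of the ideal operations on leading exponents\<close>

definition pq :: "expo \<Rightarrow>\<^sub>0 'k::field"
  where "pq = pw * (pv - pw) * pv * pv"

text \<open>The w-exponent is compared before the v-exponent, so the leading term of w v^3 - w^2 v^2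
  is -w^2 v^2.\<close>

lemma is_lead_pq:
  fixes f :: "expo \<Rightarrow>\<^sub>0 'k::field"
  assumes "is_lead f (i, k, j)"
  shows "is_lead (pq * f) (i, k + 2, j + 2)"
proof -
  have pq: "pq = Poly_Mapping.single (0, 1, 3) 1 - (Poly_Mapping.single (0, 2, 2) 1 :: expo \<Rightarrow>\<^sub>0 'k)"
    by (simp add: pq_def pv_def pw_def algebra_simps mult_single numeral_2_eq_2 numeral_3_eq_3)
  show ?thesis
    unfolding pq left_diff_distrib
    using is_lead_diff[OF is_lead_mult_single[OF assms, of "(0, 2, 2)"]
        is_lead_mult_single[OF assms, of "(0, 1, 3)"]]
    by simp
qed

text \<open>All exponents are shifted alike, which preserves their order. The leading coefficient is
  multiplied by \<open>k + j\<close>, which is nonzero in characteristic 0.\<close>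

lemma is_lead_der:
  fixes f :: "expo \<Rightarrow>\<^sub>0 'k::field_char_0"
  assumes "is_lead f (i, k, j)" "k + j > 0"
  shows "is_lead (der f) (i, k, Suc j)"
  unfolding is_lead_def
proof (intro conjI allI impI)
  show "Poly_Mapping.lookup (der f) (i, k, Suc j) \<noteq> 0"
    using assms by (simp add: lookup_der is_lead_def del: of_nat_add)
next
  fix s assume s: "Poly_Mapping.lookup (der f) s \<noteq> 0"
  obtain i' k' j' where s': "s = (i', k', j')" by (cases s)
  with s obtain j'' where j: "j' = Suc j''" by (cases j') (auto simp: lookup_der)
  with s s' have "Poly_Mapping.lookup f (i', k', j'') \<noteq> 0" by (auto simp: lookup_der)
  with assms(1) have "(i', k', j'') \<le> (i, k, j)" by (auto simp: is_lead_def)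
  then show "s \<le> (i, k, Suc j)" by (auto simp: s' j)
qed

text \<open>The trace of a two-sided ideal of B on normal forms: a subspace closed under right
  multiplication by u, the commutator with u, and left multiplication by e_1 e_3 - e_2 e_2 -
  e_4.\<close>

definition stable :: "(expo \<Rightarrow>\<^sub>0 'k::field) set \<Rightarrow> bool"
  where "stable J \<longleftrightarrow> 0 \<in> J \<and> (\<forall>f\<in>J. \<forall>g\<in>J. f + g \<in> J) \<and> (\<forall>c. \<forall>f\<in>J. const c * f \<in> J) \<and>
    (\<forall>f\<in>J. pu * f \<in> J \<and> der f \<in> J \<and> pq * f \<in> J)"

definition leads :: "(expo \<Rightarrow>\<^sub>0 'k::field) set \<Rightarrow> expo set"
  where "leads J = {t. \<exists>f\<in>J. is_lead f t}"

text \<open>Each claim iterates one operation: \<open>pu\<close>, \<open>der\<close>,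
  \<open>pq\<close>. Applying \<open>der\<close> raises j, so the condition \<open>k + j > 0\<close>
  persists.\<close>

lemma leads_add:
  fixes J :: "(expo \<Rightarrow>\<^sub>0 'k::field_char_0) set"
  assumes "stable J" "(i, k, j) \<in> leads J"
  shows "(i + a, k, j) \<in> leads J" "k + j > 0 \<Longrightarrow> (i, k, j + a) \<in> leads J"
    "(i, k + 2 * a, j + 2 * a) \<in> leads J"
proof -
  show "(i + a, k, j) \<in> leads J"
  proof (induction a)
    case (Suc a)
    then obtain f where f: "f \<in> J" "is_lead f (i + a, k, j)" by (auto simp: leads_def)
    have "is_lead (pu * f) (Suc (i + a), k, j)"
      using is_lead_mult_single[OF f(2), of "(1, 0, 0)"] by (simp add: pu_def)
    with f assms(1) show ?case by (auto simp: leads_def stable_def)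
  qed (use assms in simp)
  show "(i, k, j + a) \<in> leads J" if "k + j > 0"
  proof (induction a)
    case (Suc a)
    then obtain f where f: "f \<in> J" "is_lead f (i, k, j + a)" by (auto simp: leads_def)
    with is_lead_der[OF f(2)] assms(1) that show ?case by (auto simp: leads_def stable_def)
  qed (use assms in simp)
  show "(i, k + 2 * a, j + 2 * a) \<in> leads J"
  proof (induction a)
    case (Suc a)
    then obtain f where f: "f \<in> J" "is_lead f (i, k + 2 * a, j + 2 * a)" by (auto simp: leads_def)
    with is_lead_pq[OF f(2)] assms(1) show ?case by (auto simp: leads_def stable_def)
  qed (use assms in simp)
qed

text \<open>Reduction as for Groebner bases: cancel the leading term by an element of
  \<open>J\<close> and continue with a smaller exponent. Lexicographic order on triples of naturals
  is well-founded.\<close>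

lemma leads_subset_imp_subset:
  fixes J :: "(expo \<Rightarrow>\<^sub>0 'k::field_char_0) set"
  assumes "stable J" "stable J'" "J \<subseteq> J'" "leads J' \<subseteq> leads J"
  shows "J' \<subseteq> J"
proof -
  have *: "\<forall>f\<in>J'. is_lead f t \<longrightarrow> f \<in> J" for t
  proof (induction t rule: less_induct)
    case (less t)
    show ?case
    proof (intro ballI impI)
      fix f assume f: "f \<in> J'" "is_lead f t"
      then have "t \<in> leads J"
        using assms(4) by (auto simp: leads_def)
      then obtain g where g: "g \<in> J" "is_lead g t"
        by (auto simp: leads_def)
      \<comment> \<open>This factor cancels the coefficient at \<open>t\<close>, so \<open>h\<close>
        is zero or has a smaller leading exponent.\<close>
      define c where "c = Poly_Mapping.lookup f t / Poly_Mapping.lookup g t"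
      define h where "h = f + const (- c) * g"
      have l: "Poly_Mapping.lookup h s = Poly_Mapping.lookup f s - c * Poly_Mapping.lookup g s" for s
        using lookup_mult_single[of 0 "- c" g s] by (simp add: h_def lookup_add)
      have "h \<in> J"
      proof (cases "h = 0")
        case False
        then obtain s where s: "is_lead h s" using lead_exists by blast
        have "Poly_Mapping.lookup h t = 0"
          using g(2) by (simp add: l c_def is_lead_def)
        with s have "s \<noteq> t" unfolding is_lead_def by blast
        moreover have "s \<le> t"
        proof (cases "Poly_Mapping.lookup f s = 0")
          case True
          with s have "Poly_Mapping.lookup g s \<noteq> 0" by (auto simp: is_lead_def l)
          with g(2) show ?thesis unfolding is_lead_def by blast
        next
          case False
          with f(2) show ?thesis unfolding is_lead_def by blast
        qed
        moreover have "h \<in> J'"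
          using f(1) g(1) assms(2,3) unfolding h_def stable_def by blast
        ultimately show ?thesis using less[of s] s by (metis le_neq_trans)
      qed (use assms(1) in \<open>simp add: stable_def\<close>)
      moreover have "f = h + const c * g"
        by (simp add: h_def add.assoc flip: distrib_right single_add)
      ultimately show "f \<in> J"
        using g(1) assms(1) unfolding stable_def by metis
    qed
  qed
  show ?thesis
  proof
    fix f assume "f \<in> J'"
    then show "f \<in> J"
      using * lead_exists[of f] assms(1) unfolding stable_def by metis
  qed
qed

section \<open>Dickson's lemma and the chain condition for stable sets\<close>

lemma nat_seq_mono_subseq:
  fixes s :: "nat \<Rightarrow> nat"
  shows "\<exists>r :: nat \<Rightarrow> nat. strict_mono r \<and> mono (s \<circ> r)"
proof -
  obtain r where r: "strict_mono r" "monoseq (s \<circ> r)"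
    using seq_monosub[of s] by (auto simp: o_def)
  show ?thesis
  proof (cases "incseq (s \<circ> r)")
    case False
    with r(2) have dec: "decseq (s \<circ> r)" by (simp add: monoseq_iff)
    \<comment> \<open>A decreasing sequence of naturals is constant from the point where its minimum
      is attained; its tail is therefore increasing.\<close>
    obtain n where n: "\<And>m. (s \<circ> r) n \<le> (s \<circ> r) m"
      using ex_has_least_nat[of "\<lambda>_. True" 0 "s \<circ> r"] by auto
    have "(s \<circ> r) (n + m) = (s \<circ> r) n" for m
      using n[of "n + m"] decseqD[OF dec, of n "n + m"] by simp
    then have "mono (s \<circ> (\<lambda>m. r (n + m)))"
      by (auto simp: mono_def)
    moreover have "strict_mono (\<lambda>m. r (n + m))"
      using r(1) by (auto simp: strict_mono_def)
    ultimately show ?thesis by (intro exI conjI)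
  qed (use r in auto)
qed

text \<open>The functions are treated one at a time: thinning out further keeps the monotonicity
  already achieved.\<close>

lemma nat_seqs_mono_subseq:
  fixes t :: "nat \<Rightarrow> 'a" and fs :: "('a \<Rightarrow> nat) list"
  shows "\<exists>r :: nat \<Rightarrow> nat. strict_mono r \<and> (\<forall>f\<in>set fs. mono (\<lambda>n. f (t (r n))))"
proof (induction fs)
  case Nil
  show ?case by (auto intro: exI[of _ "\<lambda>n. n"] simp: strict_mono_def)
next
  case (Cons f fs)
  then obtain r :: "nat \<Rightarrow> nat" where r: "strict_mono r" "\<forall>f\<in>set fs. mono (\<lambda>n. f (t (r n)))" by blast
  obtain r' :: "nat \<Rightarrow> nat" where r': "strict_mono r'" "mono ((\<lambda>n. f (t (r n))) \<circ> r')"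
    using nat_seq_mono_subseq by blast
  have "mono (\<lambda>n. g (t (r (r' n))))" if "g \<in> set fs" for g
    using r(2) that strict_mono_mono[OF r'(1)] by (auto simp: mono_def)
  moreover have "strict_mono (r \<circ> r')" using r(1) r'(1) by (rule strict_mono_o)
  ultimately show ?case using r' by (intro exI[of _ "r \<circ> r'"]) (auto simp: o_def)
qed

text \<open>Dickson's lemma, applied to the exponents of the three shifts in \<open>leads_add\<close>; the parity of
  \<open>k\<close> and the condition \<open>k + j > 0\<close> are recorded by further monotone coordinates.\<close>

lemma leads_dickson:
  fixes t :: "nat \<Rightarrow> expo"
  assumes "\<And>n. fst (snd (t n)) \<le> snd (snd (t n))"
  shows "\<exists>m n. m < n \<and> (\<forall>J :: (expo \<Rightarrow>\<^sub>0 'k::field_char_0) set. stable J \<longrightarrow> t m \<in> leads J \<longrightarrow> t n \<in> leads J)"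
proof -
  \<comment> \<open>The shift by (0, 2, 2) keeps \<open>j - k\<close>, so the growth of this
    coordinate is the number of applications of \<open>der\<close>.\<close>
  let ?fs = "[\<lambda>(i, k, j). i, \<lambda>(i, k, j). k, \<lambda>(i, k, j). j - k, \<lambda>(i, k, j). k mod 2,
    \<lambda>(i, k, j). Suc k mod 2, \<lambda>(i, k, j). if k + j = 0 then 1 else 0] :: (expo \<Rightarrow> nat) list"
  obtain r :: "nat \<Rightarrow> nat" where r: "strict_mono r" "\<forall>f\<in>set ?fs. mono (\<lambda>n. f (t (r n)))"
    using nat_seqs_mono_subseq[of ?fs t] by blast
  have m: "f (t (r 0)) \<le> f (t (r (Suc 0)))" if "f \<in> set ?fs" for f
    using monoD[OF bspec[OF r(2) that], of 0 "Suc 0"] by (simp only: le0)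
  obtain i k j i' k' j' where t: "t (r 0) = (i, k, j)" "t (r (Suc 0)) = (i', k', j')"
    using prod_cases3[of "t (r 0)"] prod_cases3[of "t (r (Suc 0))"] by metis
  have le: "i \<le> i'" "k \<le> k'" "j - k \<le> j' - k'" "k mod 2 \<le> k' mod 2" "Suc k mod 2 \<le> Suc k' mod 2"
    "k + j = 0 \<Longrightarrow> k' + j' = 0"
    using m[of "\<lambda>(i, k, j). i"] m[of "\<lambda>(i, k, j). k"] m[of "\<lambda>(i, k, j). j - k"]
      m[of "\<lambda>(i, k, j). k mod 2"] m[of "\<lambda>(i, k, j). Suc k mod 2"]
      m[of "\<lambda>(i, k, j). if k + j = 0 then 1 else 0"]
    by (simp_all add: t split: if_splits)
  have kj: "k \<le> j" "k' \<le> j'" using assms[of "r 0"] assms[of "r (Suc 0)"] by (auto simp: t)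
  \<comment> \<open>Of \<open>k mod 2\<close> and \<open>Suc k mod 2\<close> one falls when the
    other rises, so neither changes.\<close>
  have "k mod 2 = k' mod 2" using le(4,5) by presburger
  define a where "a = (k' - k) div 2"
  with le(2) \<open>k mod 2 = k' mod 2\<close> have a: "k' = k + 2 * a" by presburger
  define b where "b = i' - i"
  with le(1) have b: "i' = i + b" by simp
  \<comment> \<open>As \<open>k \<le> j\<close> and \<open>k' \<le> j'\<close>, the growth of
    \<open>j - k\<close> makes this subtraction exact.\<close>
  define c where "c = j' - (j + 2 * a)"
  with le(3) kj a have c: "j' = j + 2 * a + c" by simp
  have "t (r (Suc 0)) \<in> leads J" if J: "stable J" "t (r 0) \<in> leads J" for J :: "(expo \<Rightarrow>\<^sub>0 'k) set"
  proof -
    have 1: "(i + b, k, j) \<in> leads J" using leads_add(1)[OF J(1)] J(2) t by simp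
    show ?thesis
    proof (cases "k + j = 0")
      \<comment> \<open>Here \<open>der\<close> gives no shift, but the last coordinate forces
        \<open>k' = j' = 0\<close>, and the shift in i suffices.\<close>
      case True
      with le(6) 1 show ?thesis by (simp add: t b)
    next
      case False
      then have "(i + b, k, j + c) \<in> leads J" using leads_add(2)[OF J(1) 1] by simp
      from leads_add(3)[OF J(1) this, of a] show ?thesis by (simp add: t a b c add_ac)
    qed
  qed
  moreover have "r 0 < r (Suc 0)" using r(1) by (simp add: strict_mono_def)
  ultimately show ?thesis
    by (intro exI[of _ "r 0"] exI[of _ "r (Suc 0)"]) simp
qed

text \<open>A chain that never stabilises keeps producing new leading exponents. Dickson's lemma
  finds an earlier one that forces a later one into a stage from which it was chosen to be
  absent.\<close>

lemma stable_acc: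
  fixes J :: "nat \<Rightarrow> (expo \<Rightarrow>\<^sub>0 'k::field_char_0) set"
  assumes J: "\<And>n. stable (J n)" "\<And>n. J n \<subseteq> J (Suc n)"
    and T: "\<And>n f i k j. f \<in> J n \<Longrightarrow> Poly_Mapping.lookup f (i, k, j) \<noteq> 0 \<Longrightarrow> k \<le> j"
  shows "\<exists>N. \<forall>n\<ge>N. J n = J N"
proof (rule ccontr)
  assume "\<not> ?thesis"
  then have ne: "\<exists>n\<ge>N. J n \<noteq> J N" for N by blast
  have mono: "J m \<subseteq> J n" if "m \<le> n" for m n
    using lift_Suc_mono_le[of J, OF J(2) that] .
  \<comment> \<open>By \<open>leads_subset_imp_subset\<close>, strict growth of the sets is visible
    in their leading exponents.\<close>
  have "\<exists>n t. n > N \<and> t \<in> leads (J n) \<and> t \<notin> leads (J N)" for N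
  proof -
    obtain n where n: "n \<ge> N" "J n \<noteq> J N" using ne by blast
    with mono[of N n] leads_subset_imp_subset[OF J(1) J(1), of N n] have "\<not> leads (J n) \<subseteq> leads (J N)"
      by blast
    with n show ?thesis by (metis le_neq_implies_less subsetI)
  qed
  then obtain g h where gh: "\<And>N. g N > N" "\<And>N. h N \<in> leads (J (g N))" "\<And>N. h N \<notin> leads (J N)"
    by metis
  \<comment> \<open>Stage \<open>s (Suc n)\<close> contains a leading exponent that stage
    \<open>s n\<close> lacks; \<open>t n\<close> is that exponent.\<close>
  define s where "s n = (g ^^ n) 0" for n
  have s: "strict_mono s" using gh(1) by (auto simp: s_def strict_mono_Suc_iff)
  define t where "t n = h (s n)" for n
  have t: "t n \<in> leads (J (s (Suc n)))" "t n \<notin> leads (J (s n))" for n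
    using gh by (auto simp: t_def s_def)
  have "fst (snd (t n)) \<le> snd (snd (t n))" for n
    using t(1)[of n] T by (cases "t n") (auto simp: leads_def is_lead_def)
  from leads_dickson[OF this, where ?'k = 'k] obtain m n where mn: "m < n"
    "\<And>J :: (expo \<Rightarrow>\<^sub>0 'k) set. stable J \<Longrightarrow> t m \<in> leads J \<Longrightarrow> t n \<in> leads J"
    by blast
  have "s (Suc m) \<le> s n"
    using s mn(1) by (simp add: strict_mono_less_eq)
  then have "t m \<in> leads (J (s n))"
    using t(1)[of m] mono by (fastforce simp: leads_def)
  from mn(2)[OF J(1) this] t(2)[of n] show False by simp
qed

section \<open>Exponents occurring in B\<close>

section \<open>The image of \<open>\<phi>\<close>\<close>

definition balanced :: "(expo \<Rightarrow>\<^sub>0 'k::field) \<Rightarrow> bool"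
  where "balanced f \<longleftrightarrow> (\<forall>i k j. Poly_Mapping.lookup f (i, k, j) \<noteq> 0 \<longrightarrow> k \<le> j)"

lemma balanced_add: "balanced f \<Longrightarrow> balanced g \<Longrightarrow> balanced (f + g)"
  and balanced_diff: "balanced f \<Longrightarrow> balanced g \<Longrightarrow> balanced (f - g)"
  unfolding balanced_def lookup_add lookup_minus by (metis add_0, metis diff_zero)

lemma balanced_mult_single:
  assumes "balanced f" "k \<le> j"
  shows "balanced (Poly_Mapping.single (i, k, j) c * f)"
  unfolding balanced_def
proof (intro allI impI)
  fix i' k' j' assume "Poly_Mapping.lookup (Poly_Mapping.single (i, k, j) c * f) (i', k', j') \<noteq> 0"
  then show "k' \<le> j'"
    by (rule lookup_mult_single_nonzero) (use assms in \<open>auto simp: balanced_def intro!: add_mono\<close>)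
qed

lemma balanced_der: "balanced f \<Longrightarrow> balanced (der f)"
  unfolding balanced_def
proof (intro allI impI)
  fix i k j assume "\<forall>i k j. Poly_Mapping.lookup f (i, k, j) \<noteq> 0 \<longrightarrow> k \<le> j"
    and "Poly_Mapping.lookup (der f) (i, k, j) \<noteq> 0"
  then show "k \<le> j" by (cases j) (auto simp: lookup_der intro: le_SucI)
qed

text \<open>In the image of e_n the letter w has coefficient n - 1, which vanishes for n = 1; for n
  > 1 a factor v is available to pair with w.\<close>

lemma balanced_act_witt_image:
  assumes "balanced f"
  shows "balanced (act (witt_image n) f)"
proof -
  obtain m where m: "nat_of_num n = Suc m"
    using nat_of_num_pos[of n] by (cases "nat_of_num n") auto
  define g where "g = act (letter gen_v ^ m) f"
  have g: "balanced g"
    unfolding g_def act_power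
    by (induction m) (use assms in \<open>auto simp: pv_def intro: balanced_mult_single\<close>)
  have "balanced (const (numeral n - 1) * (pw * g))"
  proof (cases m)
    case 0
    then have "n = num.One" using m by (simp add: num_eq_iff)
    then show ?thesis by (simp add: balanced_def)
  next
    case (Suc m')
    then have "pw * g = Poly_Mapping.single (0, 1, 1) 1 * act (letter gen_v ^ m') f"
      by (simp add: g_def act_mult pw_def pv_def mult_single flip: mult.assoc)
    moreover have "balanced (act (letter gen_v ^ m') f)"
      unfolding act_power by (induction m') (use assms in \<open>auto simp: pv_def intro: balanced_mult_single\<close>)
    ultimately show ?thesis
      by (simp add: zero_prod_def balanced_mult_single)
  qed
  moreover have "balanced (pu * g + der g)"
    unfolding pu_def by (intro balanced_add balanced_mult_single balanced_der g) simp
  moreover have "act (witt_image n) f = pu * g + der g - const (numeral n - 1) * (pw * g)"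
    by (simp add: witt_image_def m act_mult act_diff flip: g_def)
  ultimately show ?thesis by (simp add: balanced_diff)
qed


text \<open>Left multiplication by \<open>e\<^sub>1 e\<^sub>3 - e\<^sub>2 e\<^sub>2 - e\<^sub>4\<close>, an element of \<open>B\<close>, is thus multiplication
  by a polynomial in \<open>v\<close> and \<open>w\<close>.\<close>

lemma act_pq:
  fixes f :: "expo \<Rightarrow>\<^sub>0 'k::field"
  defines "e \<equiv> witt_image :: num \<Rightarrow> (S_gen, 'k) free_alg"
  shows "act (e num.One * e (num.Bit1 num.One) - e (num.Bit0 num.One) * e (num.Bit0 num.One)
    - e (num.Bit0 (num.Bit0 num.One))) f = pq * f"
proof -
  have c: "const 2 = (2 :: expo \<Rightarrow>\<^sub>0 'k)" "const 3 = (3 :: expo \<Rightarrow>\<^sub>0 'k)"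
    by simp_all
  have "der 2 = (0 :: expo \<Rightarrow>\<^sub>0 'k)"
    unfolding c[symmetric] by (rule der_const)
  moreover have "e num.One = gu" "e (num.Bit0 num.One) = (gu - gw) * gv"
    "e (num.Bit1 num.One) = (gu - scalar 2 * gw) * (gv * gv)"
    "e (num.Bit0 (num.Bit0 num.One)) = (gu - scalar 3 * gw) * (gv * (gv * gv))"
    by (simp_all add: e_def witt_image_def eval_nat_numeral)
  \<comment> \<open>All terms containing \<open>pu\<close> or a derivative of \<open>f\<close>
    cancel.\<close>
  ultimately show ?thesis
    by (simp add: act_mult act_diff der_add der_diff der_mult pq_def c) (simp add: algebra_simps)
qed

section \<open>Elements of B for a fixed homomorphism\<close>

locale witt_quotient =
  fixes \<phi> :: "('k::field_char_0 witt, 'k) free_alg set \<Rightarrow> (S_gen, 'k) free_alg set"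
  assumes phi: "is_phi \<phi>"
begin

abbreviation B :: "(S_gen, 'k) free_alg set ring"
  where "B \<equiv> S_alg\<lparr>carrier := \<phi> ` carrier UW\<rparr>"

lemma phi_hom: "\<phi> \<in> ring_hom (presented_algebra UW_relations) (presented_algebra S_relations)"
  and phi_scalar: "\<phi> (residue UW_relations (scalar c)) = residue S_relations (scalar c)"
  and phi_e: "\<phi> (residue UW_relations (letter (witt_e n))) = residue S_relations (witt_image n)"
  using phi by (auto simp: is_phi_def algebra_hom_def witt_image_def)

lemma phi_mult: "\<phi> (residue UW_relations (p * q)) =
    \<phi> (residue UW_relations p) \<otimes>\<^bsub>presented_algebra S_relations\<^esub> \<phi> (residue UW_relations q)"
  and phi_add: "\<phi> (residue UW_relations (p + q)) =
    \<phi> (residue UW_relations p) \<oplus>\<^bsub>presented_algebra S_relations\<^esub> \<phi> (residue UW_relations q)"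
  using ring_hom_mult[OF phi_hom] ring_hom_add[OF phi_hom]
  by (simp_all add: carrier_presented_algebra flip: residue_mult residue_add)

lemma carrier_B: "carrier B = range (\<lambda>p. \<phi> (residue UW_relations p))"
  by (auto simp: UW_def carrier_presented_algebra)

lemma B_mult: "residue S_relations p \<in> carrier B \<Longrightarrow> residue S_relations q \<in> carrier B \<Longrightarrow>
    residue S_relations (p * q) \<in> carrier B"
  and B_add: "residue S_relations p \<in> carrier B \<Longrightarrow> residue S_relations q \<in> carrier B \<Longrightarrow>
    residue S_relations (p + q) \<in> carrier B"
  unfolding carrier_B residue_mult[symmetric] residue_add[symmetric]
  by (auto simp flip: phi_mult phi_add)

lemma B_scalar: "residue S_relations (scalar c) \<in> carrier B"
  and B_e: "residue S_relations (witt_image n) \<in> carrier B"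
  unfolding carrier_B by (metis phi_scalar rangeI, metis phi_e rangeI)

lemma B_diff:
  assumes "residue S_relations p \<in> carrier B" "residue S_relations q \<in> carrier B"
  shows "residue S_relations (p - q) \<in> carrier B"
  using B_add[OF assms(1) B_mult[OF B_scalar[of "- 1"] assms(2)]] by (simp add: scalar_minus)

lemma B_u: "residue S_relations gu \<in> carrier B"
  using B_e[of num.One] by (simp add: witt_image_def)

text \<open>Stated for the operator and not for the normal form alone, so that products are handled
  by composition.\<close>

definition bal_class :: "(S_gen, 'k) free_alg set \<Rightarrow> bool"
  where "bal_class X \<longleftrightarrow> (\<exists>p. X = residue S_relations p \<and> (\<forall>f. balanced f \<longrightarrow> balanced (act p f)))"

lemma bal_class_mult: "bal_class X \<Longrightarrow> bal_class Y \<Longrightarrow> bal_class (X \<otimes>\<^bsub>presented_algebra S_relations\<^esub> Y)"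
  and bal_class_add: "bal_class X \<Longrightarrow> bal_class Y \<Longrightarrow> bal_class (X \<oplus>\<^bsub>presented_algebra S_relations\<^esub> Y)"
  unfolding bal_class_def
  by (metis residue_mult act_mult, metis residue_add act_add balanced_add)

lemma bal_class_scalar: "bal_class (residue S_relations (scalar c))"
  unfolding bal_class_def zero_prod_def
  by (intro exI[of _ "scalar c"]) (simp add: zero_prod_def balanced_mult_single)

text \<open>Every vector of the Lie algebra is a generator of the enveloping algebra; the linear
  relations reduce the claim to the basis vectors \<open>witt_e n\<close>.\<close>

lemma bal_class_letter: "bal_class (\<phi> (residue UW_relations (letter x)))"
proof -
  have letter_add: "residue UW_relations (letter (x + y)) = residue UW_relations (letter x + letter y)" for x y :: "'k witt"
    unfolding residue_eq_iff diff_diff_eq[symmetric]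
    by (rule Idl_self) (auto simp: UW_relations_def uea_relations_def)
  have letter_scale: "residue UW_relations (letter (witt_scale c x)) = residue UW_relations (scalar c * letter x)"
    for c and x :: "'k witt"
    unfolding residue_eq_iff
    by (rule Idl_self) (auto simp: UW_relations_def uea_relations_def)
  have *: "bal_class (\<phi> (residue UW_relations (letter (witt_scale c (witt_e n)))))" for c n
    unfolding letter_scale phi_mult phi_scalar phi_e
    by (rule bal_class_mult[OF bal_class_scalar])
      (auto simp: bal_class_def intro: balanced_act_witt_image)
  show ?thesis
  proof (induction x rule: witt_induct)
    case zero
    show ?case using *[of 0] by simp
  next
    case (add x y)
    then show ?case unfolding letter_add phi_add by (rule bal_class_add)
  qed (rule *)
qed

lemma bal_class_B: "X \<in> carrier B \<Longrightarrow> bal_class X"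
proof -
  have w: "bal_class (\<phi> (residue UW_relations (Poly_Mapping.single (Word xs) 1)))" for xs
  proof (induction xs)
    case Nil
    show ?case using bal_class_scalar[of 1] phi_scalar[of 1] by (simp flip: zero_fword_def)
  next
    case (Cons x xs)
    have "Poly_Mapping.single (Word (x # xs)) (1 :: 'k) = letter x * Poly_Mapping.single (Word xs) 1"
      by (simp add: letter_def mult_single plus_fword_def)
    then show ?case
      by (simp only: phi_mult bal_class_mult[OF bal_class_letter Cons])
  qed
  have "bal_class (\<phi> (residue UW_relations p))" for p
  proof (induction p rule: poly_mapping_induct)
    case (single t c)
    have "Poly_Mapping.single t c = scalar c * Poly_Mapping.single (Word (letters t)) 1"
      by (simp add: scalar_def mult_single)
    then show ?case
      by (simp only: phi_mult phi_scalar bal_class_mult[OF bal_class_scalar w])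
  next
    case (add p q)
    then show ?case unfolding phi_add by (rule bal_class_add)
  qed
  then show "X \<in> carrier B \<Longrightarrow> bal_class X"
    unfolding carrier_B by blast
qed

lemma balanced_nf:
  assumes "residue S_relations p \<in> carrier B"
  shows "balanced (nf p)"
proof -
  obtain q where q: "residue S_relations p = residue S_relations q" "\<forall>f. balanced f \<longrightarrow> balanced (act q f)"
    using bal_class_B[OF assms] unfolding bal_class_def by blast
  have "balanced (1 :: expo \<Rightarrow>\<^sub>0 'k)"
    by (auto simp: balanced_def lookup_one zero_prod_def when_def)
  with q show ?thesis
    by (metis nf_eq_iff nf_def)
qed

section \<open>From ideals of B to stable sets of normal forms\<close>

lemma stable_ideal:
  assumes "ideal I B"
  shows "stable {nf p | p. residue S_relations p \<in> I}" (is "stable ?J")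
proof -
  interpret I: ideal I B by (rule assms)
  have add: "residue S_relations (p + q) \<in> I" if "residue S_relations p \<in> I" "residue S_relations q \<in> I" for p q
    using additive_subgroup.a_closed[OF I.additive_subgroup_axioms that] by (simp add: S_alg_def residue_add)
  have l: "residue S_relations (c * p) \<in> I"
    if "residue S_relations c \<in> carrier B" "residue S_relations p \<in> I" for c p
    using I.I_l_closed[OF that(2,1)] by (simp add: S_alg_def residue_mult)
  have r: "residue S_relations (p * c) \<in> I"
    if "residue S_relations c \<in> carrier B" "residue S_relations p \<in> I" for c p
    using I.I_r_closed[OF that(2,1)] by (simp add: S_alg_def residue_mult)
  have diff: "residue S_relations (p - q) \<in> I" if "residue S_relations p \<in> I" "residue S_relations q \<in> I" for p q
    using add[OF that(1) l[OF B_scalar[of "- 1"] that(2)]] by (simp add: scalar_minus)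
  have J: "nf p \<in> ?J" if "residue S_relations p \<in> I" for p
    using that by blast
  have zero: "\<zero>\<^bsub>B\<^esub> \<in> I"
    by (rule additive_subgroup.zero_closed[OF I.additive_subgroup_axioms])
  have "I \<subseteq> carrier B"
    by (rule additive_subgroup.a_subset[OF I.additive_subgroup_axioms])
  \<comment> \<open>Multiplying a representative of the zero of B by \<open>scalar 0\<close> puts
    the class of \<open>0\<close> into \<open>I\<close>.\<close>
  from bal_class_B[OF subsetD[OF this zero]] obtain z where "\<zero>\<^bsub>B\<^esub> = residue S_relations z"
    unfolding bal_class_def by (elim exE conjE)
  with zero have "residue S_relations z \<in> I"
    by (simp only:)
  then have "residue S_relations (scalar 0 * z) \<in> I"
    by (rule l[OF B_scalar])
  then have "nf 0 \<in> ?J"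
    using J by simp
  moreover have "nf p + nf q \<in> ?J" if "residue S_relations p \<in> I" "residue S_relations q \<in> I" for p q
    using J[OF add[OF that]] by (simp only: nf_def act_add)
  moreover have "const c * nf p \<in> ?J" if "residue S_relations p \<in> I" for c p
    using J[OF l[OF B_scalar[of c] that]] by (simp only: nf_def act_mult act_scalar)
  \<comment> \<open>Since \<open>der 1 = 0\<close>, u sends 1 to \<open>pu\<close>, and
    \<open>act_pu\<close> moves this factor out.\<close>
  moreover have right_u: "nf (p * gu) = pu * nf p" for p :: "(S_gen, 'k) free_alg"
    using act_pu[of p 1] der_const[of "1 :: 'k"] by (simp add: nf_def act_mult)
  then have "pu * nf p \<in> ?J" if "residue S_relations p \<in> I" for p
    using J[OF r[OF B_u that]] by simp
  moreover have "der (nf p) \<in> ?J" if "residue S_relations p \<in> I" for p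
  proof -
    \<comment> \<open>Left multiplication gives \<open>pu * nf p + der (nf p)\<close>; the right one
      removes the first summand.\<close>
    have "nf (gu * p - p * gu) = der (nf p)"
      using right_u[of p] by (simp add: nf_def act_diff act_mult)
    with J[OF diff[OF l[OF B_u that] r[OF B_u that]]] show ?thesis by simp
  qed
  moreover have "pq * nf p \<in> ?J" if "residue S_relations p \<in> I" for p
    using J[OF l[OF B_diff[OF B_diff[OF B_mult[OF B_e B_e] B_mult[OF B_e B_e]] B_e] that]]
    unfolding nf_def act_mult[of _ p] act_pq[symmetric] .
  ultimately show ?thesis
    unfolding stable_def by (auto simp: nf_def)
qed

theorem acc_B: "acc_ideals B"
  unfolding acc_ideals_def
proof (intro allI impI)
  fix I :: "nat \<Rightarrow> (S_gen, 'k) free_alg set set"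
  assume "(\<forall>i. ideal (I i) B) \<and> (\<forall>i. I i \<subseteq> I (Suc i))"
  then have I: "\<And>i. ideal (I i) B" "\<And>i. I i \<subseteq> I (Suc i)" by auto
  define J where "J i = {nf p | p. residue S_relations p \<in> I i}" for i
  have sub: "I i \<subseteq> carrier B" for i
    using additive_subgroup.a_subset[OF ideal.axioms(1)[OF I(1)]] .
  have acc: "\<exists>N. \<forall>n\<ge>N. J n = J N"
  proof (rule stable_acc)
    show "stable (J n)" "J n \<subseteq> J (Suc n)" for n
      using stable_ideal[OF I(1)] I(2)[of n] by (auto simp: J_def)
    show "k \<le> j" if "f \<in> J n" "Poly_Mapping.lookup f (i, k, j) \<noteq> 0" for n f i k j
      using that balanced_nf sub[of n] unfolding J_def balanced_def by blast
  qed
  \<comment> \<open>An ideal is recovered from its normal forms because \<open>nf\<close> separates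
    classes, so stabilisation carries back from \<open>J\<close> to \<open>I\<close>.\<close>
  have le: "X \<in> I n" if J_le: "J m \<subseteq> J n" and X: "X \<in> I m" for m n X
  proof -
    obtain p where p: "X = residue S_relations p"
      using X sub[of m] bal_class_B[of X] unfolding bal_class_def by blast
    with J_le X obtain q where "nf p = nf q" "residue S_relations q \<in> I n"
      unfolding J_def by blast
    with p show ?thesis by (simp add: nf_eq_iff)
  qed
  from acc obtain N where N: "\<And>n. n \<ge> N \<Longrightarrow> J n = J N" by blast
  have "I n = I N" if "n \<ge> N" for n
    using le[of n N] le[of N n] N[OF that] by auto
  then show "\<exists>N. \<forall>i\<ge>N. I i = I N" by blast
qed

end

theorem proposition0p12:
  fixes \<phi> :: "('k::field_char_0 witt, 'k) free_alg set \<Rightarrow> (S_gen, 'k) free_alg set"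
  assumes "is_phi \<phi>"
  shows "acc_ideals (S_alg\<lparr>carrier := \<phi> ` carrier UW\<rparr>)"
  using witt_quotient.acc_B[of \<phi>] assms by (simp add: witt_quotient_def)

end
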